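(* Let $k_0$ be the field of functions $g$ meromorphic on $\mathbb{C}$ satisfying $g(x+1)=g(x)$, let $k=k_0(x)$, $\sigma(x)=x+1$ (that is, $\sigma(f)(x)=f(x+1)$) and $\partial=\frac{d}{dx}$. Let $a,b\in\mathbb{C}(x)$ with $a\neq0$ in standard form. Let $z$ be a function meromorphic on $\mathbb{C}$ satisfying $\sigma(z)=az+b$ and assume that $z\notin k$. Then: 1. If $a\notin\mathbb{C}$, then $z$ is not differentially algebraic over $k$. 2. If $a\in\mathbb{C}$, then $z$ is differentially algebraic over $k$ if and only if $b=\sigma(f)-af$ for some $f\in\mathbb{C}(x)$.
   Context: $a\in\mathbb{C}(x)\setminus\{0\}$ is in standard form (for $\sigma(x)=x+1$) if, for any two distinct elements $\alpha,\beta$ of the set of zeroes and poles of $a$ in $\mathbb{C}$, $\alpha\notin\beta+\mathbb{Z}$. A function $z$ is differentially algebraic over the differential field $k$ if there is a nonzero differential polynomial $P\in k\{Y\}$ with $P(z,\partial z,\partial^2 z,\ldots)=0$. *)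

theory Defs
  imports "HOL-Complex_Analysis.Complex_Analysis" "HOL-Library.Poly_Mapping"
begin

section \<open>The field of meromorphic functions on the complex plane\<close>

text \<open>
  In the library a function that is meromorphic on a set may take arbitrary values at its poles and
  on a sparse set of removable points. Two such functions are identified if they agree off a sparse
  (i.e. closed and discrete) subset of the plane; the quotient is the field of meromorphic functions.
\<close>

definition mero_rel :: "(complex \<Rightarrow> complex) \<Rightarrow> (complex \<Rightarrow> complex) \<Rightarrow> bool" where
  "mero_rel f g \<longleftrightarrow> f meromorphic_on UNIV \<and> g meromorphic_on UNIV \<and>
     eventually (\<lambda>z. f z = g z) (cosparse UNIV)"

lemma mero_relI:
  "f meromorphic_on UNIV \<Longrightarrow> g meromorphic_on UNIV \<Longrightarrow>
     eventually (\<lambda>z. f z = g z) (cosparse UNIV) \<Longrightarrow> mero_rel f g"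
  by (simp add: mero_rel_def)

lemma mero_relI':
  "f meromorphic_on UNIV \<Longrightarrow> g meromorphic_on UNIV \<Longrightarrow> (\<And>z. f z = g z) \<Longrightarrow> mero_rel f g"
  by (simp add: mero_rel_def)

lemma part_equivp_mero_rel: "part_equivp mero_rel"
proof (rule part_equivpI)
  show "\<exists>f. mero_rel f f"
    by (rule exI[of _ "\<lambda>_. 0"]) (auto simp: mero_rel_def)
  show "symp mero_rel"
    by (auto simp: symp_def mero_rel_def eq_commute)
  show "transp mero_rel"
  proof (rule transpI)
    fix f g h assume "mero_rel f g" "mero_rel g h"
    moreover from this have "eventually (\<lambda>z. f z = g z \<and> g z = h z) (cosparse UNIV)"
      by (auto simp: mero_rel_def eventually_conj_iff)
    then have "eventually (\<lambda>z. f z = h z) (cosparse UNIV)"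
      by eventually_elim auto
    ultimately show "mero_rel f h" by (auto simp: mero_rel_def)
  qed
qed

quotient_type mero = "complex \<Rightarrow> complex" / partial: mero_rel
  by (rule part_equivp_mero_rel)

lemma mero_rel_eventually_at:
  assumes "mero_rel f g"
  shows "eventually (\<lambda>w. f w = g w) (at z)"
  using assms by (auto simp: mero_rel_def intro: eventually_cosparse_imp_eventually_at)

lemma mero_rel_nonzero:
  assumes "f meromorphic_on UNIV" "\<not> mero_rel f (\<lambda>_. 0)"
  shows "eventually (\<lambda>z. f z \<noteq> 0) (cosparse UNIV)"
  using meromorphic_imp_constant_or_avoid[OF assms(1), of 0] assms
  by (auto simp: mero_rel_def open_UNIV connected_UNIV)

instantiation mero :: field
begin

lift_definition zero_mero :: mero is "\<lambda>_. 0" by (auto simp: mero_rel_def)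

lift_definition one_mero :: mero is "\<lambda>_. 1" by (auto simp: mero_rel_def)

lift_definition plus_mero :: "mero \<Rightarrow> mero \<Rightarrow> mero" is "\<lambda>f g z. f z + g z"
  unfolding mero_rel_def
  by (auto intro!: meromorphic_intros elim: eventually_elim2)

lift_definition minus_mero :: "mero \<Rightarrow> mero \<Rightarrow> mero" is "\<lambda>f g z. f z - g z"
  unfolding mero_rel_def
  by (auto intro!: meromorphic_intros elim: eventually_elim2)

lift_definition uminus_mero :: "mero \<Rightarrow> mero" is "\<lambda>f z. - f z"
  unfolding mero_rel_def
  by (auto intro!: meromorphic_intros elim: eventually_mono)

lift_definition times_mero :: "mero \<Rightarrow> mero \<Rightarrow> mero" is "\<lambda>f g z. f z * g z"
  unfolding mero_rel_def
  by (auto intro!: meromorphic_intros elim: eventually_elim2)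

lift_definition inverse_mero :: "mero \<Rightarrow> mero" is "\<lambda>f z. inverse (f z)"
  unfolding mero_rel_def
  by (auto intro!: meromorphic_intros elim: eventually_mono)

lift_definition divide_mero :: "mero \<Rightarrow> mero \<Rightarrow> mero" is "\<lambda>f g z. f z / g z"
  unfolding mero_rel_def
  by (auto intro!: meromorphic_intros elim: eventually_elim2)

instance
proof
  fix a b c :: mero
  show "a * b * c = a * (b * c)"
    by transfer (auto intro!: mero_relI' meromorphic_intros simp: mero_rel_def mult.assoc)
  show "a * b = b * a"
    by transfer (auto intro!: mero_relI' meromorphic_intros simp: mero_rel_def mult.commute)
  show "1 * a = a"
    by transfer (auto simp: mero_rel_def)
  show "a + b + c = a + (b + c)"
    by transfer (auto intro!: mero_relI' meromorphic_intros simp: mero_rel_def add.assoc)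
  show "a + b = b + a"
    by transfer (auto intro!: mero_relI' meromorphic_intros simp: mero_rel_def add.commute)
  show "0 + a = a"
    by transfer (auto simp: mero_rel_def)
  show "- a + a = 0"
    by transfer (auto simp: mero_rel_def)
  show "a - b = a + - b"
    by transfer (auto intro!: mero_relI' meromorphic_intros simp: mero_rel_def)
  show "(a + b) * c = a * c + b * c"
    by transfer (auto intro!: mero_relI' meromorphic_intros simp: mero_rel_def distrib_right)
  show "(0::mero) \<noteq> 1"
    by transfer (auto simp: mero_rel_def)
  show "inverse a * a = 1" if "a \<noteq> 0"
    using that
  proof transfer
    fix f assume f: "mero_rel f f" "\<not> mero_rel f (\<lambda>_. 0)"
    then have m: "f meromorphic_on UNIV" by (simp add: mero_rel_def)
    show "mero_rel (\<lambda>z. inverse (f z) * f z) (\<lambda>_. 1)"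
      using mero_rel_nonzero[OF m f(2)]
      by (intro mero_relI meromorphic_intros m) (auto elim: eventually_mono)
  qed
  show "a div b = a * inverse b"
    by transfer (auto intro!: mero_relI' meromorphic_intros simp: mero_rel_def divide_inverse)
  show "inverse (0::mero) = 0"
    by transfer (auto simp: mero_rel_def)
qed

end

lift_definition mero_const :: "complex \<Rightarrow> mero" is "\<lambda>c _. c"
  by (auto simp: mero_rel_def)

lift_definition mero_x :: mero is "\<lambda>z. z"
  by (auto simp: mero_rel_def)

lift_definition mero_shift :: "mero \<Rightarrow> mero" is "\<lambda>f z. f (z + 1)"
proof -
  fix f g assume fg: "mero_rel f g"
  have *: "(\<lambda>z. h (z + 1)) meromorphic_on UNIV" if "h meromorphic_on UNIV" for h :: "complex \<Rightarrow> complex"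
    by (rule meromorphic_on_compose[OF that]) (auto intro!: analytic_intros)
  have "eventually (\<lambda>z. f (z + 1) = g (z + 1)) (at w)" for w
    using mero_rel_eventually_at[OF fg, of "w + 1"]
    unfolding at_to_0[of w] at_to_0[of "w + 1"] eventually_filtermap by (simp add: add.assoc)
  then show "mero_rel (\<lambda>z. f (z + 1)) (\<lambda>z. g (z + 1))"
    using fg by (auto intro!: mero_relI * simp: mero_rel_def eventually_cosparse_open_eq)
qed

lift_definition mero_deriv :: "mero \<Rightarrow> mero" is deriv
proof -
  fix f g assume fg: "mero_rel f g"
  have "eventually (\<lambda>z. deriv f z = deriv g z) (at w)" for w
  proof -
    obtain S where S: "open S" "w \<in> S" "\<And>z. z \<in> S \<Longrightarrow> z \<noteq> w \<Longrightarrow> f z = g z"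
      using mero_rel_eventually_at[OF fg, of w] by (auto simp: eventually_at_topological)
    have "deriv f z = deriv g z" if "z \<in> S" "z \<noteq> w" for z
    proof (rule deriv_cong_ev)
      have "eventually (\<lambda>u. u \<in> S - {w}) (nhds z)"
        using S that by (intro eventually_nhds_in_open open_delete) auto
      then show "eventually (\<lambda>u. f u = g u) (nhds z)"
        by eventually_elim (use S in auto)
    qed auto
    then show ?thesis using S by (auto simp: eventually_at_topological)
  qed
  then show "mero_rel (deriv f) (deriv g)"
    using fg
    by (auto intro!: mero_relI meromorphic_intros simp: mero_rel_def eventually_cosparse_open_eq)
qed

lift_definition mero_zero_at :: "mero \<Rightarrow> complex \<Rightarrow> bool" is isolated_zero
proof (rule ext)
  fix f g z assume "mero_rel f g"
  from mero_rel_eventually_at[OF this, of z] show "isolated_zero f z = isolated_zero g z"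
    unfolding isolated_zero_def
    by (intro arg_cong2[where f = conj] tendsto_cong eventually_subst)
       (auto elim: eventually_mono)
qed

lift_definition mero_pole_at :: "mero \<Rightarrow> complex \<Rightarrow> bool" is is_pole
proof (rule ext)
  fix f g z assume "mero_rel f g"
  from mero_rel_eventually_at[OF this, of z] show "is_pole f z = is_pole g z"
    by (intro is_pole_cong) auto
qed


section \<open>Rational functions and differential polynomials\<close>

text \<open>For a subfield \<open>K\<close> of the ambient field, this is the field \<open>K(t)\<close> generated by \<open>K\<close> and \<open>t\<close>.\<close>

definition adjoin :: "'a :: field set \<Rightarrow> 'a \<Rightarrow> 'a set" where
  "adjoin K t = {poly p t / poly q t | p q.
     set (coeffs p) \<subseteq> K \<and> set (coeffs q) \<subseteq> K \<and> poly q t \<noteq> 0}"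

definition const_field :: "mero set" where
  "const_field = range mero_const"

definition rat_field :: "mero set" where
  "rat_field = adjoin const_field mero_x"

definition periodic_field :: "mero set" where
  "periodic_field = {g. mero_shift g = g}"

definition base_field :: "mero set" where
  "base_field = adjoin periodic_field mero_x"

definition standard_form :: "mero \<Rightarrow> bool" where
  "standard_form a \<longleftrightarrow>
     (\<forall>\<alpha> \<beta>. (mero_zero_at a \<alpha> \<or> mero_pole_at a \<alpha>) \<longrightarrow> (mero_zero_at a \<beta> \<or> mero_pole_at a \<beta>) \<longrightarrow>
        \<alpha> \<noteq> \<beta> \<longrightarrow> (\<forall>n::int. \<alpha> \<noteq> \<beta> + of_int n))"

text \<open>
  A differential polynomial in \<open>Y\<close> is a polynomial in the variables \<open>Y, \<partial>Y, \<partial>\<^sup>2Y, \<dots>\<close>. The monomial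
  with exponent vector \<open>m\<close> is the product of the \<open>(\<partial>\<^sup>i Y) ^ m i\<close>, and \<open>P\<close> maps \<open>m\<close> to its coefficient.
\<close>

type_synonym 'a diff_poly = "(nat \<Rightarrow>\<^sub>0 nat) \<Rightarrow>\<^sub>0 'a"

definition eval_diff_poly :: "('a :: field \<Rightarrow> 'a) \<Rightarrow> 'a diff_poly \<Rightarrow> 'a \<Rightarrow> 'a" where
  "eval_diff_poly D P z =
     (\<Sum>m\<in>Poly_Mapping.keys P. Poly_Mapping.lookup P m *
        (\<Prod>i\<in>Poly_Mapping.keys m. ((D ^^ i) z) ^ Poly_Mapping.lookup m i))"

definition differentially_algebraic :: "('a :: field \<Rightarrow> 'a) \<Rightarrow> 'a set \<Rightarrow> 'a \<Rightarrow> bool" where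
  "differentially_algebraic D K z \<longleftrightarrow>
     (\<exists>P :: 'a diff_poly. P \<noteq> 0 \<and> (\<forall>m. Poly_Mapping.lookup P m \<in> K) \<and> eval_diff_poly D P z = 0)"

end

theory Submission
  imports Defs "HOL-Computational_Algebra.Fundamental_Theorem_Algebra"
begin

text \<open>
  Write \<open>z\<^sub>i\<close> for the derivatives of \<open>z\<close>. If \<open>z\<close> is differentially algebraic, some \<open>z\<^sub>n\<close> is algebraic
  over \<open>F\<^sub>n = k(z\<^sub>0, \<dots>, z\<^sub>n\<^sub>-\<^sub>1)\<close> with \<open>z\<^sub>0, \<dots>, z\<^sub>n\<^sub>-\<^sub>1\<close> independent, and the subleading coefficient of its
  minimal polynomial solves the equation of \<open>z\<^sub>n\<close> inside \<open>F\<^sub>n\<close>. Take the least \<open>m\<close> such that the equation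
  of \<open>z\<^sub>m\<close> has a solution in \<open>F\<^sub>m\<close>. By minimality, solutions in \<open>F\<^sub>j(z\<^sub>j)\<close> of related first-order equations
  have no denominators and low degree in \<open>z\<^sub>j\<close>, so they descend step by step to \<open>k\<close>.
  For constant \<open>a\<close> this yields \<open>L(b) = \<sigma>(f) - a f\<close> with \<open>f\<close> in \<open>k\<close> and \<open>L\<close> a monic linear differential
  operator over \<open>k\<^sub>0\<close>. For nonconstant \<open>a\<close> in standard form it yields \<open>\<sigma>(h) = h + a'/a\<close> if \<open>m > 0\<close>; if
  \<open>m = 0\<close>, subtracting a solution in \<open>k\<close> gives \<open>\<sigma>(w) = a w\<close>, and the constant case applied to \<open>w'/w\<close>
  over \<open>k(w)\<close> gives \<open>L(a'/a) = \<sigma>(f) - f\<close>.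
  Evaluating periodic coefficients at a generic point moves these identities to rational functions
  over the constants, where they are decided by poles: on a class \<open>\<alpha> + \<int>\<close> a function of the form
  \<open>\<sigma>(f) - l f\<close>, with \<open>l\<close> a nonzero constant, cannot have exactly one pole, whereas \<open>L\<close> preserves the
  set of poles, and \<open>b\<close> can be normalised modulo such functions to have its poles in a strip of width one.
\<close>

section \<open>Subfields and polynomials over them\<close>

text \<open>Subfields are sets in one ambient field, so that fields generated by varying elements
  can be compared by inclusion. Closure under the total \<open>inverse\<close> is harmless at zero
  because \<open>inverse 0 = 0\<close>.\<close>

definition is_subfield :: "'a :: field set \<Rightarrow> bool" where
  "is_subfield K \<longleftrightarrow> 1 \<in> K \<and> (\<forall>x\<in>K. \<forall>y\<in>K. x - y \<in> K \<and> x * y \<in> K) \<and> (\<forall>x\<in>K. inverse x \<in> K)"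

lemma is_subfield_0: "is_subfield K \<Longrightarrow> 0 \<in> K"
  unfolding is_subfield_def by (metis diff_self)

lemma is_subfield_1: "is_subfield K \<Longrightarrow> 1 \<in> K"
  unfolding is_subfield_def by blast

lemma is_subfield_minus: "is_subfield K \<Longrightarrow> x \<in> K \<Longrightarrow> y \<in> K \<Longrightarrow> x - y \<in> K"
  unfolding is_subfield_def by blast

lemma is_subfield_mult: "is_subfield K \<Longrightarrow> x \<in> K \<Longrightarrow> y \<in> K \<Longrightarrow> x * y \<in> K"
  unfolding is_subfield_def by blast

lemma is_subfield_inverse: "is_subfield K \<Longrightarrow> x \<in> K \<Longrightarrow> inverse x \<in> K"
  unfolding is_subfield_def by blast

lemma is_subfield_uminus: "is_subfield K \<Longrightarrow> x \<in> K \<Longrightarrow> - x \<in> K"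
  using is_subfield_minus[of K 0 x] is_subfield_0[of K] by simp

lemma is_subfield_add: "is_subfield K \<Longrightarrow> x \<in> K \<Longrightarrow> y \<in> K \<Longrightarrow> x + y \<in> K"
  using is_subfield_minus[of K x "-y"] is_subfield_uminus[of K y] by simp

lemma is_subfield_divide: "is_subfield K \<Longrightarrow> x \<in> K \<Longrightarrow> y \<in> K \<Longrightarrow> x / y \<in> K"
  by (simp add: divide_inverse is_subfield_mult is_subfield_inverse)

lemma is_subfield_power: "is_subfield K \<Longrightarrow> x \<in> K \<Longrightarrow> x ^ n \<in> K"
  by (induction n) (auto intro: is_subfield_mult is_subfield_1)

lemma is_subfield_of_nat: "is_subfield K \<Longrightarrow> of_nat n \<in> K"
  by (induction n) (auto intro: is_subfield_add is_subfield_1 is_subfield_0)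

lemma is_subfield_sum: "is_subfield K \<Longrightarrow> (\<And>i. i \<in> A \<Longrightarrow> f i \<in> K) \<Longrightarrow> sum f A \<in> K"
  by (induction A rule: infinite_finite_induct) (auto intro: is_subfield_add is_subfield_0)

lemma is_subfield_prod: "is_subfield K \<Longrightarrow> (\<And>i. i \<in> A \<Longrightarrow> f i \<in> K) \<Longrightarrow> prod f A \<in> K"
  by (induction A rule: infinite_finite_induct) (auto intro: is_subfield_mult is_subfield_1)

lemmas is_subfield_intros =
  is_subfield_0 is_subfield_1 is_subfield_add is_subfield_minus is_subfield_uminus
  is_subfield_mult is_subfield_inverse is_subfield_divide is_subfield_power is_subfield_of_nat
  is_subfield_sum is_subfield_prod

section \<open>Polynomials over a subfield and simple extensions\<close>

definition polys_over :: "'a :: field set \<Rightarrow> 'a poly set" where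
  "polys_over K = {p. \<forall>i. coeff p i \<in> K}"

lemma polys_over_coeff: "p \<in> polys_over K \<Longrightarrow> coeff p i \<in> K"
  by (simp add: polys_over_def)

lemma polys_over_mono: "K \<subseteq> L \<Longrightarrow> polys_over K \<subseteq> polys_over L"
  by (auto simp: polys_over_def)

lemma polys_over_iff_coeffs: "0 \<in> K \<Longrightarrow> p \<in> polys_over K \<longleftrightarrow> set (coeffs p) \<subseteq> K"
  using forall_coeffs_conv[of "\<lambda>c. c \<in> K" p] by (auto simp: polys_over_def)

lemma adjoin_altdef:
  "is_subfield K \<Longrightarrow>
     adjoin K t = {poly p t / poly q t | p q. p \<in> polys_over K \<and> q \<in> polys_over K \<and> poly q t \<noteq> 0}"
  unfolding adjoin_def by (simp add: polys_over_iff_coeffs is_subfield_0)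

context
  fixes K :: "'a :: field set"
  assumes K: "is_subfield K"
begin

lemma polys_over_0: "0 \<in> polys_over K"
  by (simp add: polys_over_def is_subfield_0[OF K])

lemma polys_over_const: "c \<in> K \<Longrightarrow> [:c:] \<in> polys_over K"
  by (auto simp: polys_over_def coeff_pCons is_subfield_0[OF K] split: nat.split)

lemma polys_over_1: "1 \<in> polys_over K"
  using polys_over_const[of 1] by (simp add: is_subfield_1[OF K] one_pCons)

lemma polys_over_pCons: "c \<in> K \<Longrightarrow> p \<in> polys_over K \<Longrightarrow> pCons c p \<in> polys_over K"
  by (auto simp: polys_over_def coeff_pCons split: nat.split)

lemma polys_over_add: "p \<in> polys_over K \<Longrightarrow> q \<in> polys_over K \<Longrightarrow> p + q \<in> polys_over K"
  by (auto simp: polys_over_def intro: is_subfield_add[OF K])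

lemma polys_over_diff: "p \<in> polys_over K \<Longrightarrow> q \<in> polys_over K \<Longrightarrow> p - q \<in> polys_over K"
  by (auto simp: polys_over_def intro: is_subfield_minus[OF K])

lemma polys_over_mult: "p \<in> polys_over K \<Longrightarrow> q \<in> polys_over K \<Longrightarrow> p * q \<in> polys_over K"
  by (auto simp: polys_over_def coeff_mult intro!: is_subfield_sum[OF K] is_subfield_mult[OF K])

lemma polys_over_smult: "c \<in> K \<Longrightarrow> q \<in> polys_over K \<Longrightarrow> smult c q \<in> polys_over K"
  by (auto simp: polys_over_def intro!: is_subfield_mult[OF K])

lemma polys_over_monom: "c \<in> K \<Longrightarrow> monom c n \<in> polys_over K"
  by (auto simp: polys_over_def is_subfield_0[OF K])

lemma polys_over_pcompose: "p \<in> polys_over K \<Longrightarrow> q \<in> polys_over K \<Longrightarrow> pcompose p q \<in> polys_over K"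
proof (induction p)
  case (pCons c p)
  have "c \<in> K" "p \<in> polys_over K"
    using polys_over_coeff[OF pCons.prems(1), of 0] polys_over_coeff[OF pCons.prems(1), of "Suc i" for i]
    by (auto simp: polys_over_def)
  then show ?case
    using pCons by (auto simp: pcompose_pCons intro!: polys_over_add polys_over_const polys_over_mult)
qed (auto simp: polys_over_0)

lemmas polys_over_intros = polys_over_0 polys_over_1 polys_over_const polys_over_pCons
  polys_over_add polys_over_diff polys_over_mult polys_over_smult polys_over_monom polys_over_pcompose

lemma adjoinI:
  "p \<in> polys_over K \<Longrightarrow> q \<in> polys_over K \<Longrightarrow> poly q t \<noteq> 0 \<Longrightarrow> poly p t / poly q t \<in> adjoin K t"
  by (auto simp: adjoin_altdef[OF K])

lemma adjoinE:
  assumes "f \<in> adjoin K t"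
  obtains p q where "p \<in> polys_over K" "q \<in> polys_over K" "poly q t \<noteq> 0" "f = poly p t / poly q t"
  using assms by (auto simp: adjoin_altdef[OF K])

lemma poly_in_adjoin: "p \<in> polys_over K \<Longrightarrow> poly p t \<in> adjoin K t"
  using adjoinI[of p 1 t] polys_over_1 by simp

lemma subset_adjoin: "K \<subseteq> adjoin K t"
  using poly_in_adjoin[of "[:c:]" t for c] polys_over_const by fastforce

lemma gen_in_adjoin: "t \<in> adjoin K t"
  using poly_in_adjoin[of "[:0, 1:]" t]
  by (simp add: polys_over_intros is_subfield_0[OF K] is_subfield_1[OF K])

lemma is_subfield_adjoin: "is_subfield (adjoin K t)"
  unfolding is_subfield_def
proof (intro conjI ballI)
  show "1 \<in> adjoin K t"
    using subset_adjoin is_subfield_1[OF K] by blast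
next
  fix x y assume "x \<in> adjoin K t" "y \<in> adjoin K t"
  then obtain p q p' q' where *: "p \<in> polys_over K" "q \<in> polys_over K" "poly q t \<noteq> 0"
    "x = poly p t / poly q t" "p' \<in> polys_over K" "q' \<in> polys_over K" "poly q' t \<noteq> 0"
    "y = poly p' t / poly q' t"
    by (elim adjoinE) blast
  show "x - y \<in> adjoin K t"
    using adjoinI[of "p * q' - p' * q" "q * q'" t] * by (simp add: polys_over_intros diff_frac_eq)
  show "x * y \<in> adjoin K t"
    using adjoinI[of "p * p'" "q * q'" t] * by (simp add: polys_over_intros)
next
  fix x assume "x \<in> adjoin K t"
  then obtain p q where *: "p \<in> polys_over K" "q \<in> polys_over K" "poly q t \<noteq> 0"
    "x = poly p t / poly q t"
    by (elim adjoinE) blast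
  show "inverse x \<in> adjoin K t"
  proof (cases "poly p t = 0")
    case True
    then show ?thesis using * subset_adjoin is_subfield_0[OF K] by auto
  next
    case False
    then show ?thesis using adjoinI[of q p t] * by simp
  qed
qed

text \<open>This minimality is how closure of an extension under a map is proved later: the elements
  with good images form a subfield containing K and t.\<close>

lemma adjoin_least:
  assumes "is_subfield L" "K \<subseteq> L" "t \<in> L"
  shows "adjoin K t \<subseteq> L"
proof
  fix f assume "f \<in> adjoin K t"
  then obtain p q where *: "p \<in> polys_over K" "q \<in> polys_over K" "f = poly p t / poly q t"
    by (elim adjoinE) blast
  have "poly r t \<in> L" if "r \<in> polys_over K" for r
    unfolding poly_altdef
    using that assms polys_over_coeff
    by (intro is_subfield_sum is_subfield_mult is_subfield_power) auto
  with * assms(1) show "f \<in> L" by (auto intro!: is_subfield_divide)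
qed

end

section \<open>Algebraic elements and minimal monic polynomials\<close>

definition algebraic_over :: "'a :: field set \<Rightarrow> 'a \<Rightarrow> bool" where
  "algebraic_over K t \<longleftrightarrow> (\<exists>p\<in>polys_over K. p \<noteq> 0 \<and> poly p t = 0)"

lemma algebraic_over_mono: "K \<subseteq> L \<Longrightarrow> algebraic_over K t \<Longrightarrow> algebraic_over L t"
  unfolding algebraic_over_def using polys_over_mono by blast

text \<open>Transcendence of t turns an identity between values at t into an identity of
  polynomials, after which coefficients can be compared.\<close>

lemma transcendental_poly_eqD:
  assumes "is_subfield K" "\<not> algebraic_over K t" "p \<in> polys_over K" "q \<in> polys_over K"
    "poly p t = poly q t"
  shows "p = q"
  using assms polys_over_diff[OF assms(1,3,4)] by (auto simp: algebraic_over_def)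

text \<open>Substituting cX + d into a relation for c t + d gives a relation for t, and it is
  nonzero because c is.\<close>

lemma algebraic_over_affine:
  assumes K: "is_subfield K" and t: "algebraic_over K (c * t + d)" and "c \<in> K" "c \<noteq> 0" "d \<in> K"
  shows "algebraic_over K t"
proof -
  obtain p where p: "p \<in> polys_over K" "p \<noteq> 0" "poly p (c * t + d) = 0"
    using t by (auto simp: algebraic_over_def)
  have "pcompose p [:d, c:] \<noteq> 0"
    using p(2) assms(4) by (auto simp: pcompose_eq_0_iff)
  moreover have "pcompose p [:d, c:] \<in> polys_over K"
    using assms p by (intro polys_over_intros) auto
  moreover have "poly (pcompose p [:d, c:]) t = 0"
    using p(3) by (simp add: poly_pcompose algebra_simps)
  ultimately show ?thesis by (auto simp: algebraic_over_def)
qed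

text \<open>
  The ideal of denominators and the ideal of relations are compared with their images under an
  endomorphism through this uniqueness property, which replaces divisibility arguments.
\<close>

lemma monic_minimal_unique:
  assumes K: "is_subfield K"
    and I: "\<And>p q. p \<in> I \<Longrightarrow> q \<in> I \<Longrightarrow> p - q \<in> I" "\<And>c p. c \<in> K \<Longrightarrow> p \<in> I \<Longrightarrow> smult c p \<in> I"
      "I \<subseteq> polys_over K"
    and ex: "\<exists>p\<in>I. p \<noteq> 0"
  obtains p where "p \<in> I" "lead_coeff p = 1" "\<And>r. r \<in> I \<Longrightarrow> r \<noteq> 0 \<Longrightarrow> degree p \<le> degree r"
    "\<And>q. q \<in> I \<Longrightarrow> degree q = degree p \<Longrightarrow> lead_coeff q = 1 \<Longrightarrow> q = p"
proof -
  define d where "d = (LEAST d. \<exists>p\<in>I. p \<noteq> 0 \<and> degree p = d)"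
  have "\<exists>d. \<exists>p\<in>I. p \<noteq> 0 \<and> degree p = d" using ex by blast
  from LeastI_ex[OF this] obtain p where p: "p \<in> I" "p \<noteq> 0" "degree p = d"
    unfolding d_def by blast
  have min: "d \<le> degree r" if "r \<in> I" "r \<noteq> 0" for r
    unfolding d_def using that by (intro Least_le) blast
  define p' where "p' = smult (inverse (lead_coeff p)) p"
  have "lead_coeff p \<in> K" using p(1) I(3) by (auto simp: polys_over_def)
  then have p': "p' \<in> I" "lead_coeff p' = 1" "degree p' = d"
    using p I(2) is_subfield_inverse[OF K] by (auto simp: p'_def)
  have "q = p'" if q: "q \<in> I" "degree q = d" "lead_coeff q = 1" for q
  proof (rule ccontr)
    assume "q \<noteq> p'"
    then have "q - p' \<noteq> 0" by simp
    moreover from this have "degree (q - p') < d"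
      using q p' by (metis (no_types, lifting) coeff_diff diff_self leading_coeff_0_iff
          degree_diff_le le_neq_implies_less order_refl)
    ultimately show False using min[of "q - p'"] I(1) q(1) p'(1) by auto
  qed
  note unique = this
  show ?thesis
  proof (rule that[of p'])
    show "degree p' \<le> degree r" if "r \<in> I" "r \<noteq> 0" for r
      using min[OF that] p'(3) by simp
    show "q = p'" if "q \<in> I" "degree q = degree p'" "lead_coeff q = 1" for q
      using unique[of q] that p'(3) by blast
  qed (fact p')+
qed

section \<open>First-order equations in simple extensions\<close>

text \<open>Only the two highest coefficients of p(cX + s) enter the comparisons below. A degree
  bound in place of the exact degree lets the Horner induction pass to the tail of p.\<close>

lemma coeff_pcompose_affine:
  fixes p :: "'a :: comm_ring_1 poly"
  assumes "degree p \<le> Suc d"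
  shows "coeff (pcompose p [:s, c:]) (Suc d) = c ^ Suc d * coeff p (Suc d) \<and>
         coeff (pcompose p [:s, c:]) d = c ^ d * (coeff p d + of_nat (Suc d) * s * coeff p (Suc d))"
  using assms
proof (induction d arbitrary: p)
  case 0
  obtain x y where "p = [:x, y:]"
    using 0 by (metis One_nat_def degree1_coeffs degree_pCons_0 le_Suc_eq le_zero_eq degree_eq_zeroE pCons_0_0)
  then show ?case by (simp add: pcompose_pCons algebra_simps)
next
  case (Suc d)
  obtain x q where p: "p = pCons x q" by (cases p)
  have q: "degree q \<le> Suc d" using Suc.prems p by (cases "q = 0") auto
  have 1: "coeff (pcompose q [:s, c:]) (Suc (Suc d)) = 0"
    using q degree_pcompose_le[of q "[:s, c:]"]
    by (intro coeff_eq_0) (auto intro: order.strict_trans1 split: if_splits)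
  show ?case using Suc.IH[OF q] 1
    by (simp add: p pcompose_pCons coeff_pCons algebra_simps split: nat.splits)
qed

lemma degree_pcompose_affine:
  fixes p :: "'a :: idom poly"
  assumes "c \<noteq> 0"
  shows "degree (pcompose p [:s, c:]) = degree p"
  using assms by (simp add: degree_pcompose)

section \<open>Field endomorphisms and their action on polynomials\<close>

locale field_endo =
  fixes \<sigma> :: "'a :: field_char_0 \<Rightarrow> 'a"
  assumes hom_add: "\<sigma> (x + y) = \<sigma> x + \<sigma> y"
    and hom_mult: "\<sigma> (x * y) = \<sigma> x * \<sigma> y"
    and hom_1 [simp]: "\<sigma> 1 = 1"
begin

lemma hom_0 [simp]: "\<sigma> 0 = 0"
  using hom_add[of 0 0] by simp

lemma hom_uminus: "\<sigma> (- x) = - \<sigma> x"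
  using hom_add[of x "-x"] by (simp add: eq_neg_iff_add_eq_0 add.commute)

lemma hom_diff: "\<sigma> (x - y) = \<sigma> x - \<sigma> y"
  using hom_add[of x "-y"] by (simp add: hom_uminus)

lemma hom_eq_0_iff [simp]: "\<sigma> x = 0 \<longleftrightarrow> x = 0"
proof
  assume "\<sigma> x = 0"
  then show "x = 0" using hom_mult[of x "inverse x"] by (cases "x = 0") auto
qed auto

lemma hom_inverse: "\<sigma> (inverse x) = inverse (\<sigma> x)"
  using hom_mult[of x "inverse x"] by (cases "x = 0") (auto simp: field_simps)

lemma hom_divide: "\<sigma> (x / y) = \<sigma> x / \<sigma> y"
  by (simp add: divide_inverse hom_mult hom_inverse)

lemma hom_power: "\<sigma> (x ^ n) = \<sigma> x ^ n"
  by (induction n) (auto simp: hom_mult)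

lemma hom_of_nat [simp]: "\<sigma> (of_nat n) = of_nat n"
  by (induction n) (auto simp: hom_add)

lemma hom_sum: "\<sigma> (sum f A) = (\<Sum>i\<in>A. \<sigma> (f i))"
  by (induction A rule: infinite_finite_induct) (auto simp: hom_add)

lemmas hom_simps = hom_add hom_diff hom_uminus hom_mult hom_divide hom_inverse hom_power hom_sum

lemma hom_poly: "\<sigma> (poly p t) = poly (map_poly \<sigma> p) (\<sigma> t)"
  by (induction p) (auto simp: hom_add hom_mult map_poly_pCons)

text \<open>The preimage of L under \<sigma> is a subfield that contains K and t.\<close>

lemma hom_adjoin:
  assumes "is_subfield K" "is_subfield L" "\<And>x. x \<in> K \<Longrightarrow> \<sigma> x \<in> L" "\<sigma> t \<in> L"
  shows "x \<in> adjoin K t \<Longrightarrow> \<sigma> x \<in> L"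
proof -
  have "is_subfield {x. \<sigma> x \<in> L}"
    using assms(2) by (auto simp: is_subfield_def hom_simps)
  then have "adjoin K t \<subseteq> {x. \<sigma> x \<in> L}"
    using assms by (intro adjoin_least) auto
  then show "x \<in> adjoin K t \<Longrightarrow> \<sigma> x \<in> L" by auto
qed

text \<open>For \<sigma>(t) = c t + s this is the action of \<sigma> on K[t] lifted to polynomials:
  coefficients are mapped by \<sigma> and the variable goes to cX + s.\<close>

definition twist :: "'a \<Rightarrow> 'a \<Rightarrow> 'a poly \<Rightarrow> 'a poly" where
  "twist c s p = pcompose (map_poly \<sigma> p) [:s, c:]"

lemma poly_twist: "\<sigma> t = c * t + s \<Longrightarrow> poly (twist c s p) t = \<sigma> (poly p t)"
  by (simp add: twist_def hom_poly poly_pcompose algebra_simps)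

lemma degree_twist: "c \<noteq> 0 \<Longrightarrow> degree (twist c s p) = degree p"
  by (simp add: twist_def degree_pcompose_affine degree_map_poly)

lemma coeff_twist:
  assumes "degree p \<le> Suc d"
  shows "coeff (twist c s p) (Suc d) = c ^ Suc d * \<sigma> (coeff p (Suc d))"
    "coeff (twist c s p) d = c ^ d * (\<sigma> (coeff p d) + of_nat (Suc d) * s * \<sigma> (coeff p (Suc d)))"
  using coeff_pcompose_affine[of "map_poly \<sigma> p" d s c] assms
  by (auto simp: twist_def coeff_map_poly degree_map_poly)

lemma lead_coeff_twist: "c \<noteq> 0 \<Longrightarrow> lead_coeff (twist c s p) = c ^ degree p * \<sigma> (lead_coeff p)"
  using coeff_twist(1)[of p "degree p - 1" c s] degree_twist[of c s p]
  by (cases "degree p") (auto simp: twist_def coeff_map_poly elim!: degree_eq_zeroE simp: map_poly_pCons)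

text \<open>For s = 0 the twist acts diagonally, so an eigenvector equation splits into one equation
  per coefficient.\<close>

lemma coeff_twist_0:
  "coeff (twist c 0 p) i = c ^ i * \<sigma> (coeff p i)"
  by (induction p arbitrary: i)
     (auto simp: twist_def map_poly_pCons pcompose_pCons coeff_pCons split: nat.split)

lemma twist_polys_over:
  assumes "is_subfield K" "\<And>x. x \<in> K \<Longrightarrow> \<sigma> x \<in> K" "c \<in> K" "s \<in> K" "p \<in> polys_over K"
  shows "twist c s p \<in> polys_over K"
proof -
  have "map_poly \<sigma> p \<in> polys_over K" using assms by (auto simp: polys_over_def coeff_map_poly)
  then show ?thesis unfolding twist_def using assms by (intro polys_over_intros)
qed

text \<open>
  Comparing the two highest coefficients of \<open>\<sigma>(p) = l p + r\<close>: the negative quotient of the second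
  coefficient by \<open>n\<close> times the leading one solves the equation satisfied by the generator.
\<close>

lemma solution_from_twist_eigenvector:
  assumes K: "is_subfield K"
    and c: "c \<noteq> 0" "l \<noteq> 0" and p: "p \<in> polys_over K" "degree p = Suc d"
    and eq: "twist c s p = smult l p + r" and r: "coeff r (Suc d) = 0" "coeff r d = 0"
  shows "\<exists>g\<in>K. \<sigma> g = c * g + s"
proof -
  define u where "u = coeff p (Suc d)"
  define v where "v = coeff p d"
  define n :: 'a where "n = of_nat (Suc d)"
  have "u \<noteq> 0" using p(2) unfolding u_def by (metis leading_coeff_0_iff degree_0 nat.simps(3))
  have 1: "c ^ Suc d * \<sigma> u = l * u"
    using arg_cong[OF eq, of "\<lambda>q. coeff q (Suc d)"] coeff_twist(1)[of p d c s] p(2) r(1)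
    by (simp add: u_def)
  have 2: "c ^ d * (\<sigma> v + n * s * \<sigma> u) = l * v"
    using arg_cong[OF eq, of "\<lambda>q. coeff q d"] coeff_twist(2)[of p d c s] p(2) r(2)
    by (simp add: u_def v_def n_def)
  define g where "g = - v / (n * u)"
  have n: "n \<noteq> 0" "\<sigma> n = n" by (auto simp: n_def simp del: of_nat_Suc)
  have "g \<in> K" using p K unfolding g_def u_def v_def n_def
    by (intro is_subfield_intros polys_over_coeff)
  moreover have "\<sigma> g = c * g + s"
  proof -
    have "\<sigma> u \<noteq> 0" using \<open>u \<noteq> 0\<close> by simp
    \<comment> \<open>The claim in cross-multiplied form: relation \<open>2\<close> is multiplied by
      \<open>c * u\<close>, and \<open>l * u\<close> is then eliminated by relation
      \<open>1\<close>.\<close>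
    have "(c ^ d * \<sigma> v) * (c * u) = (c ^ d * \<sigma> u) * (c * (c * v) - n * s * c * u)"
    proof -
      have a: "c ^ d * \<sigma> v = l * v - c ^ d * n * s * \<sigma> u" using 2 by (simp add: algebra_simps)
      have b: "l * u = c * (c ^ d * \<sigma> u)" using 1[symmetric] by (simp only: power_Suc mult.assoc)
      have "(c ^ d * \<sigma> v) * (c * u) = c * v * (l * u) - c * u * c ^ d * n * s * \<sigma> u"
        unfolding a by (simp add: algebra_simps)
      then show ?thesis unfolding b by (simp add: algebra_simps)
    qed
    then have "c ^ d * c * (\<sigma> v * u) = c ^ d * c * (\<sigma> u * (c * v - n * s * u))"
      by (simp add: algebra_simps)
    then have *: "\<sigma> v * u = \<sigma> u * (c * v - n * s * u)" using c by simp
    have v: "\<sigma> v = \<sigma> u * ((c * v - n * s * u) / u)"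
      using * \<open>u \<noteq> 0\<close> by (metis nonzero_mult_div_cancel_right times_divide_eq_right)
    have "\<sigma> g = - \<sigma> v / (n * \<sigma> u)" by (simp add: g_def hom_simps n)
    also have "\<dots> = - (c * v - n * s * u) / (n * u)"
      unfolding v using \<open>u \<noteq> 0\<close> \<open>\<sigma> u \<noteq> 0\<close> n by (simp add: field_simps)
    also have "\<dots> = c * g + s"
      using \<open>u \<noteq> 0\<close> n by (simp add: g_def field_simps)
    finally show ?thesis .
  qed
  ultimately show ?thesis by blast
qed

section \<open>First-order equations in K(t)\<close>

context
  fixes K :: "'a set" and c s t :: 'a
  assumes K: "is_subfield K" and \<sigma>K: "\<And>x. x \<in> K \<Longrightarrow> \<sigma> x \<in> K"
    and c: "c \<in> K" "c \<noteq> 0" and s: "s \<in> K" and t: "\<sigma> t = c * t + s"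
begin

text \<open>The twist of the minimal polynomial, divided by its leading coefficient, is again a
  monic relation of least degree. Uniqueness therefore makes the minimal polynomial an eigenvector
  of the twist.\<close>

lemma algebraic_minimal_poly:
  assumes "algebraic_over K t"
  obtains p where "p \<in> polys_over K" "lead_coeff p = 1" "poly p t = 0" "degree p > 0"
    "twist c s p = smult (c ^ degree p) p"
    "\<And>r. r \<in> polys_over K \<Longrightarrow> r \<noteq> 0 \<Longrightarrow> poly r t = 0 \<Longrightarrow> degree p \<le> degree r"
proof -
  define I where "I = {p \<in> polys_over K. poly p t = 0}"
  have "\<exists>p\<in>I. p \<noteq> 0" using assms by (auto simp: I_def algebraic_over_def)
  then obtain p where pI: "p \<in> I" "lead_coeff p = 1"
    "\<And>r. r \<in> I \<Longrightarrow> r \<noteq> 0 \<Longrightarrow> degree p \<le> degree r"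
    "\<And>q. q \<in> I \<Longrightarrow> degree q = degree p \<Longrightarrow> lead_coeff q = 1 \<Longrightarrow> q = p"
    by (rule monic_minimal_unique[OF K, rotated 3])
       (auto simp: I_def intro: polys_over_diff[OF K] polys_over_smult[OF K])
  have p: "p \<in> polys_over K" "poly p t = 0" "lead_coeff p = 1" using pI by (auto simp: I_def)
  define q where "q = smult (inverse (c ^ degree p)) (twist c s p)"
  have "q \<in> polys_over K"
    unfolding q_def using K c s p(1) \<sigma>K
    by (intro polys_over_smult twist_polys_over is_subfield_intros)
  moreover have "poly q t = 0" by (simp add: q_def poly_twist[OF t] p(2))
  moreover have "degree q = degree p" "lead_coeff q = 1"
    using c lead_coeff_twist[of c s p] p(3) by (auto simp: q_def degree_twist)
  ultimately have "q = p" by (intro pI(4)) (auto simp: I_def)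
  then have "twist c s p = smult (c ^ degree p) p"
    using c by (metis q_def smult_smult right_inverse power_not_zero smult_1_left)
  moreover have "degree p > 0"
    using p(2,3) by (auto intro!: gr0I elim!: degree_eq_zeroE)
  ultimately show ?thesis using p pI(3) by (intro that[of p]) (simp_all add: I_def)
qed

lemma algebraic_solution:
  assumes "algebraic_over K t"
  shows "\<exists>g\<in>K. \<sigma> g = c * g + s"
proof -
  obtain p where p: "p \<in> polys_over K" "lead_coeff p = 1" "degree p > 0"
    "twist c s p = smult (c ^ degree p) p"
    using algebraic_minimal_poly[OF assms] by metis
  from p(3) obtain d where d: "degree p = Suc d" by (cases "degree p") auto
  show ?thesis
    using solution_from_twist_eigenvector[OF K _ _ p(1) d, of c "c ^ degree p" s 0] p c by auto
qed

text \<open>The witness y is the constant coefficient of the minimal polynomial and e its degree. It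
  is nonzero, since otherwise a factor X could be cancelled to give a shorter relation for the
  nonzero t.\<close>

lemma algebraic_semi_invariant:
  assumes "algebraic_over K t" "s = 0" "t \<noteq> 0"
  shows "\<exists>y\<in>K. \<exists>e>0. y \<noteq> 0 \<and> \<sigma> y = c ^ e * y"
proof -
  obtain p where p: "p \<in> polys_over K" "lead_coeff p = 1" "poly p t = 0" "degree p > 0"
    "twist c s p = smult (c ^ degree p) p"
    "\<And>r. r \<in> polys_over K \<Longrightarrow> r \<noteq> 0 \<Longrightarrow> poly r t = 0 \<Longrightarrow> degree p \<le> degree r"
    using algebraic_minimal_poly[OF assms(1)] by metis
  have "coeff p 0 \<noteq> 0"
  proof
    assume "coeff p 0 = 0"
    obtain x q where "p = pCons x q" by (cases p)
    with \<open>coeff p 0 = 0\<close> have q: "p = pCons 0 q" by simp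
    have "q \<noteq> 0" using p(2) q by auto
    moreover have "q \<in> polys_over K"
      using polys_over_coeff[OF p(1), of "Suc i" for i] by (auto simp: q polys_over_def)
    moreover have "poly q t = 0" using p(3) q assms(3) by simp
    ultimately have "degree p \<le> degree q" by (intro p(6))
    then show False using q \<open>q \<noteq> 0\<close> by simp
  qed
  moreover have "\<sigma> (coeff p 0) = c ^ degree p * coeff p 0"
    using arg_cong[OF p(5), of "\<lambda>p. coeff p 0"] assms(2) by (simp add: coeff_twist_0)
  ultimately show ?thesis using p polys_over_coeff[OF p(1)] by blast
qed

text \<open>The polynomials q with q(t) f in K[t] form an ideal. Applying \<sigma> to q(t) f = p(t)
  and inserting the equation of f shows that the ideal is stable under the twist, so its monic
  element of least degree is an eigenvector.\<close>

lemma minimal_denominator: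
  assumes f: "f \<in> adjoin K t" "\<sigma> f = l * f + poly \<gamma> t" "l \<in> K" "l \<noteq> 0" "\<gamma> \<in> polys_over K"
    and tr: "\<not> algebraic_over K t"
  obtains p q where "p \<in> polys_over K" "q \<in> polys_over K" "lead_coeff q = 1" "poly q t \<noteq> 0"
    "f = poly p t / poly q t" "twist c s q = smult (c ^ degree q) q"
proof -
  define I where "I = {q \<in> polys_over K. \<exists>p\<in>polys_over K. poly q t * f = poly p t}"
  have II: "q - q' \<in> I" if qq: "q \<in> I" "q' \<in> I" for q q'
  proof -
    obtain p p' where "p \<in> polys_over K" "poly q t * f = poly p t"
      "p' \<in> polys_over K" "poly q' t * f = poly p' t" using qq unfolding I_def by blast
    then show ?thesis using qq
      by (auto simp: I_def left_diff_distrib intro!: polys_over_diff[OF K] bexI[of _ "p - p'"])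
  qed
  have III: "smult d q \<in> I" if dq: "d \<in> K" "q \<in> I" for d q
  proof -
    obtain p where "p \<in> polys_over K" "poly q t * f = poly p t" using dq unfolding I_def by blast
    then show ?thesis using dq
      by (auto simp: I_def mult.assoc intro!: polys_over_smult[OF K] bexI[of _ "smult d p"])
  qed
  have "\<exists>p\<in>I. p \<noteq> 0"
  proof -
    obtain p q where "p \<in> polys_over K" "q \<in> polys_over K" "poly q t \<noteq> 0" "f = poly p t / poly q t"
      using f(1) by (elim adjoinE[OF K])
    then show ?thesis by (intro bexI[of _ q]) (auto simp: I_def)
  qed
  then obtain q where q: "q \<in> I" "lead_coeff q = 1"
    "\<And>r. r \<in> I \<Longrightarrow> degree r = degree q \<Longrightarrow> lead_coeff r = 1 \<Longrightarrow> r = q"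
    by (rule monic_minimal_unique[OF K, rotated 3]) (use II III in \<open>auto simp: I_def\<close>)
  then obtain p where p: "p \<in> polys_over K" "q \<in> polys_over K" "poly q t * f = poly p t"
    by (auto simp: I_def)
  define q' where "q' = smult (inverse (c ^ degree q)) (twist c s q)"
  have tw: "twist c s r \<in> polys_over K" if "r \<in> polys_over K" for r
    using K c s that \<sigma>K by (intro twist_polys_over)
  have "twist c s q \<in> I"
  proof -
    have "poly (twist c s q) t * (l * f + poly \<gamma> t) = poly (twist c s p) t"
      using arg_cong[OF p(3), of \<sigma>] f(2) by (simp add: hom_mult poly_twist[OF t])
    then have "poly (twist c s q) t * f =
        poly (smult (inverse l) (twist c s p - twist c s q * \<gamma>)) t"
      using f(4) by (simp add: field_simps)
    moreover have "smult (inverse l) (twist c s p - twist c s q * \<gamma>) \<in> polys_over K"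
      using K p f(3,5)
      by (intro polys_over_smult polys_over_diff polys_over_mult is_subfield_inverse tw)
    ultimately show ?thesis unfolding I_def using tw[OF p(2)] by blast
  qed
  then have "q' \<in> I" unfolding q'_def using K c by (intro III is_subfield_intros)
  moreover have "degree q' = degree q" "lead_coeff q' = 1"
    using c lead_coeff_twist[of c s q] q(2) by (auto simp: q'_def degree_twist)
  ultimately have "q' = q" by (intro q(3))
  then have "twist c s q = smult (c ^ degree q) q"
    using c by (metis q'_def smult_smult right_inverse power_not_zero smult_1_left)
  moreover have "q \<noteq> 0" using q(2) by auto
  then have "poly q t \<noteq> 0" using p(2) tr by (auto simp: algebraic_over_def)
  ultimately show ?thesis using p q(2) by (intro that[of p q]) (auto simp: field_simps)
qed

text \<open>A denominator of positive degree would be a twist eigenvector and thus yield a solution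
  in K of the equation of t, which is excluded by assumption.\<close>

lemma polynomial_solution:
  assumes f: "f \<in> adjoin K t" "\<sigma> f = l * f + poly \<gamma> t" "l \<in> K" "l \<noteq> 0" "\<gamma> \<in> polys_over K"
    and tr: "\<not> algebraic_over K t"
    and no: "\<not> (\<exists>g\<in>K. \<sigma> g = c * g + s)"
  obtains p where "p \<in> polys_over K" "f = poly p t" "twist c s p = smult l p + \<gamma>"
proof -
  obtain p q where pq: "p \<in> polys_over K" "q \<in> polys_over K" "lead_coeff q = 1" "poly q t \<noteq> 0"
    "f = poly p t / poly q t" "twist c s q = smult (c ^ degree q) q"
    using minimal_denominator[OF f tr] by metis
  have "degree q = 0"
  proof (rule ccontr)
    assume "degree q \<noteq> 0"
    then obtain d where "degree q = Suc d" by (cases "degree q") auto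
    then show False
      using solution_from_twist_eigenvector[OF K _ _ pq(2), of c "c ^ degree q" d s 0] pq c no by auto
  qed
  then have "q = 1" using pq(3) by (auto simp: one_pCons elim!: degree_eq_zeroE)
  then have fp: "f = poly p t" using pq by simp
  have "poly (twist c s p) t = poly (smult l p + \<gamma>) t"
    using f(2) fp by (simp add: poly_twist[OF t])
  then have "twist c s p = smult l p + \<gamma>"
    using K \<sigma>K c s pq(1) f
    by (intro transcendental_poly_eqD[OF K tr] twist_polys_over polys_over_intros)
  then show ?thesis using that pq(1) fp by blast
qed

end

end

section \<open>Towers of simple extensions\<close>

text \<open>The index counts adjoined generators: \<open>tower K z n\<close> is K(z_0, ...,
  z_(n-1)), the field over which \<open>z n\<close> is tested for algebraicity.\<close>

primrec tower :: "'a :: field set \<Rightarrow> (nat \<Rightarrow> 'a) \<Rightarrow> nat \<Rightarrow> 'a set" where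
  "tower K z 0 = K"
| "tower K z (Suc n) = adjoin (tower K z n) (z n)"

lemma is_subfield_tower: "is_subfield K \<Longrightarrow> is_subfield (tower K z n)"
  by (induction n) (auto intro: is_subfield_adjoin)

lemma tower_Suc_subset: "is_subfield K \<Longrightarrow> tower K z n \<subseteq> tower K z (Suc n)"
  using subset_adjoin[OF is_subfield_tower] by simp

lemma tower_mono: "is_subfield K \<Longrightarrow> m \<le> n \<Longrightarrow> tower K z m \<subseteq> tower K z n"
  by (rule lift_Suc_mono_le) (use tower_Suc_subset in blast)

lemma base_subset_tower: "is_subfield K \<Longrightarrow> K \<subseteq> tower K z n"
  using tower_mono[of K 0 n z] by simp

lemma gen_in_tower: "is_subfield K \<Longrightarrow> i < n \<Longrightarrow> z i \<in> tower K z n"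
  using gen_in_adjoin[OF is_subfield_tower[of K z i], of "z i"] tower_mono[of K "Suc i" n z] by auto

text \<open>The sum is read as a polynomial in the last generator. By transcendence each of its
  coefficients vanishes, and each coefficient is a sum of the same kind over the monomials with a
  fixed last exponent.\<close>

lemma monomials_independent:
  assumes K: "is_subfield K" and tr: "\<And>n. n < N \<Longrightarrow> \<not> algebraic_over (tower K z n) (z n)"
    and "finite S" and "\<And>m m'. m \<in> S \<Longrightarrow> m' \<in> S \<Longrightarrow> (\<And>i. i < N \<Longrightarrow> e m i = e m' i) \<Longrightarrow> m = m'"
    and "\<And>m. m \<in> S \<Longrightarrow> c m \<in> K"
    and "(\<Sum>m\<in>S. c m * (\<Prod>i<N. z i ^ e m i)) = 0"
  shows "\<forall>m\<in>S. c m = 0"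
  using tr assms(3-)
proof (induction N arbitrary: S)
  case 0
  show ?case
  proof
    fix m assume m: "m \<in> S"
    then have "S = {m}" using 0(3) by auto
    with 0(5) show "c m = 0" by simp
  qed
next
  case (Suc N)
  define P where "P = (\<Sum>m\<in>S. monom (c m * (\<Prod>i<N. z i ^ e m i)) (e m N))"
  have mem: "c m * (\<Prod>i<N. z i ^ e m i) \<in> tower K z N" if "m \<in> S" for m
    using Suc.prems(4)[OF that] base_subset_tower[OF K, of z N] gen_in_tower[OF K, of _ N z]
    by (intro is_subfield_mult is_subfield_prod is_subfield_power is_subfield_tower K) auto
  have coeff: "coeff P j = (\<Sum>m\<in>{m\<in>S. e m N = j}. c m * (\<Prod>i<N. z i ^ e m i))" for j
    using Suc.prems(2) by (simp add: P_def coeff_sum sum.inter_filter if_distrib cong: if_cong)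
  have "P \<in> polys_over (tower K z N)"
    using mem by (auto simp: polys_over_def coeff intro!: is_subfield_sum is_subfield_tower K)
  moreover have "poly P (z N) = 0"
    using Suc.prems(5) by (simp add: P_def poly_sum poly_monom mult_ac)
  ultimately have "P = 0"
    using Suc.prems(1)[of N] by (auto simp: algebraic_over_def)
  show ?case
  proof
    fix m assume m: "m \<in> S"
    define j where "j = e m N"
    have "\<forall>m\<in>{m\<in>S. e m N = j}. c m = 0"
    proof (rule Suc.IH)
      show "\<not> algebraic_over (tower K z n) (z n)" if "n < N" for n
        using Suc.prems(1) that by simp
      show "finite {m \<in> S. e m N = j}" using Suc.prems(2) by simp
      show "(\<Sum>m\<in>{m\<in>S. e m N = j}. c m * (\<Prod>i<N. z i ^ e m i)) = 0"
        using coeff[of j] \<open>P = 0\<close> by simp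
      show "m1 = m2" if "m1 \<in> {m\<in>S. e m N = j}" "m2 \<in> {m\<in>S. e m N = j}"
        "\<And>i. i < N \<Longrightarrow> e m1 i = e m2 i" for m1 m2
        using that by (intro Suc.prems(3)) (auto simp: less_Suc_eq)
    qed (use Suc.prems(4) in auto)
    then show "c m = 0" using m by (auto simp: j_def)
  qed
qed

text \<open>If every derivative were transcendental over the field of the lower ones, the monomials
  of a differential polynomial would be linearly independent and all its coefficients would
  vanish.\<close>

lemma differentially_algebraic_imp_algebraic_over_tower:
  assumes K: "is_subfield K" and "differentially_algebraic D K z"
  shows "\<exists>n. algebraic_over (tower K (\<lambda>i. (D ^^ i) z) n) ((D ^^ n) z)"
proof (rule ccontr)
  assume no: "\<not> ?thesis"
  obtain P :: "'a diff_poly" where P: "P \<noteq> 0" "\<And>m. Poly_Mapping.lookup P m \<in> K"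
    "eval_diff_poly D P z = 0"
    using assms(2) by (auto simp: differentially_algebraic_def)
  \<comment> \<open>\<open>N\<close> exceeds every order of derivative occurring in
    \<open>P\<close>. The inserted 0 keeps \<open>Max\<close> meaningful when only the constant
    monomial occurs.\<close>
  define N where "N = Suc (Max (insert 0 (\<Union>m\<in>Poly_Mapping.keys P. Poly_Mapping.keys m)))"
  have N: "i < N" if "m \<in> Poly_Mapping.keys P" "i \<in> Poly_Mapping.keys m" for m i
    unfolding N_def using that by (intro le_imp_less_Suc Max_ge) auto
  have prod: "(\<Prod>i\<in>Poly_Mapping.keys m. ((D ^^ i) z) ^ Poly_Mapping.lookup m i) =
      (\<Prod>i<N. ((D ^^ i) z) ^ Poly_Mapping.lookup m i)" if "m \<in> Poly_Mapping.keys P" for m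
    using N that by (intro prod.mono_neutral_left) (auto simp: in_keys_iff)
  have "\<forall>m\<in>Poly_Mapping.keys P. Poly_Mapping.lookup P m = 0"
  proof (rule monomials_independent[OF K])
    show "(\<Sum>m\<in>Poly_Mapping.keys P. Poly_Mapping.lookup P m *
        (\<Prod>i<N. ((D ^^ i) z) ^ Poly_Mapping.lookup m i)) = 0"
      using P(3) prod by (simp add: eval_diff_poly_def)
    show "m = m'" if "m \<in> Poly_Mapping.keys P" "m' \<in> Poly_Mapping.keys P"
      "\<And>i. i < N \<Longrightarrow> Poly_Mapping.lookup m i = Poly_Mapping.lookup m' i" for m m'
    proof (rule poly_mapping_eqI)
      show "Poly_Mapping.lookup m i = Poly_Mapping.lookup m' i" for i
      proof (cases "i < N")
        case False
        then have "i \<notin> Poly_Mapping.keys m" "i \<notin> Poly_Mapping.keys m'"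
          using that N by blast+
        then show ?thesis by (simp add: in_keys_iff)
      qed (use that in simp)
    qed
  qed (use no P in auto)
  then have "P = 0" by (intro poly_mapping_eqI) (auto simp: in_keys_iff)
  with P(1) show False by simp
qed

context field_endo
begin

lemma hom_tower:
  assumes K: "is_subfield K" "\<And>x. x \<in> K \<Longrightarrow> \<sigma> x \<in> K"
    and z: "\<And>i. \<sigma> (z i) \<in> tower K z (Suc i)"
  shows "x \<in> tower K z n \<Longrightarrow> \<sigma> x \<in> tower K z n"
proof (induction n arbitrary: x)
  case (Suc n)
  show ?case
    by (rule hom_adjoin[OF is_subfield_tower[OF K(1)] is_subfield_tower[OF K(1)] _ z])
       (use Suc tower_Suc_subset[OF K(1)] in auto)
qed (use assms in auto)

text \<open>
  A difference version of Ostrowski's theorem: algebraic relations among solutions of inhomogeneous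
  equations with the same homogeneous part reduce to linear ones.
\<close>

lemma linear_relation:
  assumes K: "is_subfield K" and \<sigma>K: "\<And>x. x \<in> K \<Longrightarrow> \<sigma> x \<in> K"
    and fixK: "\<And>x. \<sigma> x = x \<Longrightarrow> x \<in> K"
    and l: "l \<in> K" "l \<noteq> 0" and b: "\<And>i. b i \<in> K" and z: "\<And>i. \<sigma> (z i) = l * z i + b i"
    and alg: "algebraic_over (tower K z n) (z n)"
  shows "\<exists>n C f. f \<in> K \<and> (\<forall>i<n. \<sigma> (C i) = C i) \<and> \<sigma> f = l * f + (b n - (\<Sum>i<n. C i * b i))"
proof -
  let ?F = "tower K z"
  note F = is_subfield_tower[OF K, of z]
  have KF: "x \<in> ?F n" if "x \<in> K" for x n using base_subset_tower[OF K, of z n] that by blast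
  have \<sigma>F: "\<sigma> x \<in> ?F n" if "x \<in> ?F n" for x n
  proof (rule hom_tower[OF K \<sigma>K _ that])
    show "\<sigma> (z i) \<in> ?F (Suc i)" for i
      unfolding z
      by (intro is_subfield_add is_subfield_mult F KF[OF l(1)] KF[OF b] gen_in_tower[OF K]) simp
  qed
  define n where "n = (LEAST n. algebraic_over (?F n) (z n))"
  have n: "algebraic_over (?F n) (z n)" unfolding n_def using alg by (rule LeastI)
  have tr: "\<not> algebraic_over (?F i) (z i)" if "i < n" for i
    using not_less_Least[of i "\<lambda>n. algebraic_over (?F n) (z n)"] that by (simp add: n_def)
  \<comment> \<open>\<open>Q m\<close> says that the equation of \<open>z m\<close> is solvable in
    the field of the earlier generators. Below the least such m, which is at most n, the generators
    are transcendental and have unsolvable equations, so \<open>polynomial_solution\<close> applies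
    at each level.\<close>
  define Q where "Q = (\<lambda>m. \<exists>g\<in>?F m. \<sigma> g = l * g + b m)"
  have "Q n" unfolding Q_def by (rule algebraic_solution[OF F \<sigma>F KF[OF l(1)] l(2) KF[OF b] z n])
  define m where "m = (LEAST m. Q m)"
  have "Q m" unfolding m_def using \<open>Q n\<close> by (rule LeastI)
  have "m \<le> n" unfolding m_def using \<open>Q n\<close> by (rule Least_le)
  have no: "\<not> Q i" if "i < m" for i
    using not_less_Least[of i Q] that by (simp add: m_def)
  \<comment> \<open>Generators are eliminated from the top: a solution one level up has the form v +
    u z_j with \<sigma>(u) = u, and v solves the equation whose right-hand side is reduced by u
    b_j.\<close>
  have descend: "\<exists>C f'. f' \<in> K \<and> (\<forall>i<j. \<sigma> (C i) = C i) \<and>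
      \<sigma> f' = l * f' + (\<gamma> - (\<Sum>i<j. C i * b i))"
    if "j \<le> m" "f \<in> ?F j" "\<gamma> \<in> K" "\<sigma> f = l * f + \<gamma>" for j f \<gamma>
    using that
  proof (induction j arbitrary: f \<gamma>)
    case 0
    then show ?case by (intro exI[of _ f] exI[of _ undefined]) auto
  next
    case (Suc j)
    have j: "j < m" "j < n" using Suc.prems(1) \<open>m \<le> n\<close> by auto
    have f: "f \<in> adjoin (?F j) (z j)" "\<sigma> f = l * f + poly [:\<gamma>:] (z j)" using Suc.prems by auto
    have g: "\<not> (\<exists>g\<in>?F j. \<sigma> g = l * g + b j)" using no[OF j(1)] by (simp add: Q_def)
    obtain p where p: "p \<in> polys_over (?F j)" "f = poly p (z j)"
      "twist l (b j) p = smult l p + [:\<gamma>:]"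
      using polynomial_solution[OF F \<sigma>F KF[OF l(1)] l(2) KF[OF b] z f KF[OF l(1)] l(2)
          polys_over_const[OF F KF[OF Suc.prems(3)]] tr[OF j(2)] g] by blast
    \<comment> \<open>The inhomogeneous term is free of z_j. In degree 2 or more it would not reach
      the two highest coefficients, and these would solve the equation of z_j.\<close>
    have deg: "degree p \<le> Suc 0"
    proof (rule ccontr)
      assume "\<not> ?thesis"
      then obtain d where d: "degree p = Suc (Suc d)"
        by (metis Suc_le_D not_less_eq_eq)
      have "\<exists>g\<in>?F j. \<sigma> g = l * g + b j"
        using solution_from_twist_eigenvector[OF F l(2) l(2) p(1) d p(3)] by (simp add: coeff_pCons)
      with g show False by blast
    qed
    define u v where "u = coeff p (Suc 0)" and "v = coeff p 0"
    have "p = [:v, u:]"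
      using deg by (intro poly_eqI) (auto simp: u_def v_def coeff_pCons coeff_eq_0 split: nat.split)
    then have fuv: "f = v + u * z j" using p(2) by simp
    have "l * \<sigma> u = l * u" "\<sigma> v + b j * \<sigma> u = l * v + \<gamma>"
      using coeff_twist[OF deg, of l "b j"] arg_cong[OF p(3), of "\<lambda>p. coeff p (Suc 0)"]
        arg_cong[OF p(3), of "\<lambda>p. coeff p 0"] by (auto simp: u_def v_def)
    then have u: "\<sigma> u = u" and v: "\<sigma> v = l * v + (\<gamma> - u * b j)" using l by (auto simp: algebra_simps)
    have "\<gamma> - u * b j \<in> K"
      using Suc.prems(3) fixK[OF u] b K by (intro is_subfield_minus is_subfield_mult)
    moreover have "v \<in> ?F j" using p(1) by (simp add: v_def polys_over_coeff)
    ultimately obtain C f' where C: "f' \<in> K" "\<forall>i<j. \<sigma> (C i) = C i"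
      "\<sigma> f' = l * f' + (\<gamma> - u * b j - (\<Sum>i<j. C i * b i))"
      using Suc.IH[of v "\<gamma> - u * b j"] j v by auto
    have "(\<Sum>i<Suc j. (C(j := u)) i * b i) = (\<Sum>i<j. C i * b i) + u * b j"
      by (simp add: lessThan_Suc)
    with C u show ?case
      by (intro exI[of _ "C(j := u)"] exI[of _ f']) (auto simp: less_Suc_eq algebra_simps)
  qed
  obtain g where "g \<in> ?F m" "\<sigma> g = l * g + b m" using \<open>Q m\<close> by (auto simp: Q_def)
  from descend[OF order.refl this(1) b this(2)] show ?thesis by blast
qed

end

section \<open>The case of a nonconstant multiplier\<close>

locale diff_field_endo = field_endo +
  fixes D :: "'a \<Rightarrow> 'a"
  assumes D_add: "D (x + y) = D x + D y"
    and D_mult: "D (x * y) = D x * y + x * D y"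
    and D_hom: "D (\<sigma> x) = \<sigma> (D x)"
begin

lemma D_0 [simp]: "D 0 = 0"
  using D_add[of 0 0] by simp

lemma D_1 [simp]: "D 1 = 0"
  using D_mult[of 1 1] by simp

lemma D_uminus: "D (- x) = - D x"
  using D_add[of x "-x"] by (simp add: eq_neg_iff_add_eq_0 add.commute)

lemma D_diff: "D (x - y) = D x - D y"
  using D_add[of x "-y"] by (simp add: D_uminus)

lemma D_inverse: "D (inverse x) = - D x * inverse x * inverse x"
proof (cases "x = 0")
  case False
  have "D x * inverse x + x * D (inverse x) = 0"
    using D_mult[of x "inverse x"] False by simp
  then have "x * D (inverse x) = - D x * inverse x" by (simp add: eq_neg_iff_add_eq_0 add.commute)
  then have "D (inverse x) = inverse x * (- D x * inverse x)"
    using False by (metis mult.assoc left_inverse mult_1)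
  then show ?thesis by (simp add: mult_ac)
qed auto

lemma D_of_nat [simp]: "D (of_nat n) = 0"
  by (induction n) (auto simp: D_add)

lemma D_adjoin:
  assumes K: "is_subfield K" and L: "is_subfield L"
    and "\<And>x. x \<in> K \<Longrightarrow> x \<in> L \<and> D x \<in> L" "t \<in> L" "D t \<in> L" and x: "x \<in> adjoin K t"
  shows "D x \<in> L"
proof -
  have "is_subfield {x. x \<in> L \<and> D x \<in> L}"
    using is_subfield_intros[OF L] unfolding is_subfield_def
    by (auto simp: D_diff D_mult D_inverse)
  then have "adjoin K t \<subseteq> {x. x \<in> L \<and> D x \<in> L}"
    using assms by (intro adjoin_least) auto
  with x show ?thesis by auto
qed

text \<open>Each differentiation costs at most one generator. The base field may lose a level as
  well: for the base K(w) used below, D w = w u_0 already involves the first generator.\<close>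

lemma D_tower:
  assumes K: "is_subfield K" and "\<And>x. x \<in> K \<Longrightarrow> D x \<in> tower K z (Suc 0)"
    and "\<And>i. D (z i) \<in> tower K z (Suc (Suc i))"
  shows "x \<in> tower K z n \<Longrightarrow> D x \<in> tower K z (Suc n)"
proof (induction n arbitrary: x)
  case (Suc n)
  show ?case
  proof (rule D_adjoin[of "tower K z n" _ "z n"])
    show "y \<in> tower K z (Suc (Suc n)) \<and> D y \<in> tower K z (Suc (Suc n))" if "y \<in> tower K z n" for y
      using Suc.IH[OF that] that tower_mono[OF K, of n "Suc (Suc n)" z]
        tower_mono[OF K, of "Suc n" "Suc (Suc n)" z] by (auto simp del: tower.simps)
    show "z n \<in> tower K z (Suc (Suc n))" by (rule gen_in_tower[OF K]) simp
  qed (use assms Suc.prems is_subfield_tower[OF K] in \<open>auto simp del: tower.simps(2) simp: tower.simps(2)[of K z n]\<close>)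
qed (use assms in auto)

text \<open>What has to be known about a is isolated in two obstructions: no positive power of a has
  the form \<sigma>(y)/y, and no monic linear operator with invariant coefficients sends D a / a to
  some \<sigma>(f) - f. For rational functions both are proved below from zeros and poles.\<close>

context
  fixes K :: "'a set" and a b z :: 'a
  assumes K: "is_subfield K" and \<sigma>K: "\<And>x. x \<in> K \<Longrightarrow> \<sigma> x \<in> K" and DK: "\<And>x. x \<in> K \<Longrightarrow> D x \<in> K"
    and fixK: "\<And>x. \<sigma> x = x \<Longrightarrow> x \<in> K"
    and a: "a \<in> K" "a \<noteq> 0" and b: "b \<in> K" and z: "\<sigma> z = a * z + b" "z \<notin> K"
    and no_semi_invariant: "\<And>y e. y \<in> K \<Longrightarrow> y \<noteq> 0 \<Longrightarrow> e > 0 \<Longrightarrow> \<sigma> y \<noteq> a ^ e * y"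
    and no_telescoper: "\<And>n C f. f \<in> K \<Longrightarrow> (\<And>i. i < n \<Longrightarrow> \<sigma> (C i) = C i) \<Longrightarrow>
       \<sigma> f \<noteq> f + ((D ^^ n) (D a / a) - (\<Sum>i<n. C i * (D ^^ i) (D a / a)))"
begin

lemma DK_iter: "x \<in> K \<Longrightarrow> (D ^^ n) x \<in> K"
  by (induction n) (auto intro: DK)

text \<open>The difference w = z - f satisfies \<sigma>(w) = a w and is transcendental over K by the
  first obstruction. Passing from z to w and the derivatives of D w / w gives a linear relation over
  K(w), which is then brought down to K against the second obstruction.\<close>

lemma homogeneous_case:
  assumes f: "f \<in> K" "\<sigma> f = a * f + b"
  shows "\<not> algebraic_over (tower K (\<lambda>i. (D ^^ i) z) n) ((D ^^ n) z)"
proof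
  assume alg: "algebraic_over (tower K (\<lambda>i. (D ^^ i) z) n) ((D ^^ n) z)"
  let ?F = "tower K (\<lambda>i. (D ^^ i) z)"
  define w where "w = z - f"
  have w: "w \<noteq> 0" "\<sigma> w = a * w + 0" using f z by (auto simp: w_def hom_diff algebra_simps)
  have w_tr: "\<not> algebraic_over K w"
  proof
    assume "algebraic_over K w"
    from algebraic_semi_invariant[OF K \<sigma>K a is_subfield_0[OF K] w(2) this refl w(1)]
    show False using no_semi_invariant by blast
  qed
  \<comment> \<open>Differentiating \<sigma>(w) = a w gives \<sigma>(u_0) = u_0 + D a / a, so all
    u_i satisfy equations with the common multiplier 1, as \<open>linear_relation\<close>
    requires.\<close>
  define u where "u = (\<lambda>i. (D ^^ i) (D w / w))"
  have Dw: "D w = w * u 0" using w(1) by (simp add: u_def)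
  define \<delta> where "\<delta> = (\<lambda>i. (D ^^ i) (D a / a))"
  have \<delta>K: "\<delta> i \<in> K" for i
    unfolding \<delta>_def using a DK K by (intro DK_iter is_subfield_divide) auto
  have u: "\<sigma> (u i) = 1 * u i + \<delta> i" for i
  proof (induction i)
    case 0
    have "\<sigma> (D w) = D a * w + a * D w" using D_hom[of w] w(2) by (simp add: D_mult)
    then show ?case using a w(1,2) by (simp add: u_def \<delta>_def hom_divide field_simps)
  next
    case (Suc i)
    have "\<sigma> (u (Suc i)) = D (\<sigma> (u i))" by (simp add: u_def D_hom)
    then show ?case by (simp add: Suc) (simp add: D_add u_def \<delta>_def)
  qed
  define K1 where "K1 = adjoin K w"
  have K1: "is_subfield K1" unfolding K1_def by (rule is_subfield_adjoin[OF K])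
  have KK1: "x \<in> K1" if "x \<in> K" for x using subset_adjoin[OF K] that by (auto simp: K1_def)
  have wK1: "w \<in> K1" unfolding K1_def by (rule gen_in_adjoin[OF K])
  let ?G = "tower K1 u"
  note G = is_subfield_tower[OF K1, of u]
  have uG: "u i \<in> ?G n" if "i < n" for i n using that by (rule gen_in_tower[OF K1])
  have K1G: "x \<in> ?G n" if "x \<in> K1" for x n using base_subset_tower[OF K1] that by blast
  have DG: "D x \<in> ?G (Suc n)" if "x \<in> ?G n" for x n
  proof (rule D_tower[OF K1 _ _ that])
    show "D (u i) \<in> ?G (Suc (Suc i))" for i
      using uG[of "Suc i" "Suc (Suc i)"] by (simp add: u_def del: tower.simps)
    show "D x \<in> ?G (Suc 0)" if "x \<in> K1" for x
    proof (rule D_adjoin[OF K G _ _ _ that[unfolded K1_def]])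
      show "D w \<in> ?G (Suc 0)" unfolding Dw by (intro is_subfield_mult G K1G[OF wK1] uG) simp
    qed (use K1G KK1 wK1 DK in \<open>auto simp del: tower.simps\<close>)
  qed
  \<comment> \<open>The change of generators is triangular: derivative i + 1 of z is affine in u_i
    with slope w. Algebraicity of the former over the smaller field therefore passes to u_i.\<close>
  have zu: "\<exists>v\<in>?G i. (D ^^ Suc i) z = w * u i + v" for i
  proof (induction i)
    case 0
    have "D z = w * u 0 + D f" using Dw by (simp add: w_def D_diff diff_eq_eq)
    moreover have "D f \<in> ?G 0" using f DK KK1 by auto
    ultimately show ?case by auto
  next
    case (Suc i)
    then obtain v where v: "v \<in> ?G i" "(D ^^ Suc i) z = w * u i + v" by blast
    have "(D ^^ Suc (Suc i)) z = D (w * u i + v)" using v(2) by simp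
    also have "\<dots> = w * u (Suc i) + (w * u 0 * u i + D v)"
      by (simp add: D_add D_mult Dw algebra_simps) (simp add: u_def)
    finally have "(D ^^ Suc (Suc i)) z = w * u (Suc i) + (w * u 0 * u i + D v)" .
    moreover have "w * u 0 * u i + D v \<in> ?G (Suc i)"
      by (intro is_subfield_add is_subfield_mult G K1G[OF wK1] uG DG v) auto
    ultimately show ?case by blast
  qed
  have FG: "?F (Suc i) \<subseteq> ?G i" for i
  proof (induction i)
    case 0
    have "z = w + f" by (simp add: w_def)
    then have "z \<in> K1" using f K1 KK1 wK1 by (auto intro: is_subfield_add)
    then have "adjoin K z \<subseteq> K1" using KK1 by (intro adjoin_least[OF K K1]) auto
    then show ?case by simp
  next
    case (Suc i)
    obtain v where v: "v \<in> ?G i" "(D ^^ Suc i) z = w * u i + v" using zu by blast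
    have "(D ^^ Suc i) z \<in> ?G (Suc i)"
      unfolding v(2) using v(1) tower_Suc_subset[OF K1, of u i]
      by (intro is_subfield_add is_subfield_mult G K1G[OF wK1] uG) auto
    then have "adjoin (?F (Suc i)) ((D ^^ Suc i) z) \<subseteq> ?G (Suc i)"
      using Suc tower_Suc_subset[OF K1, of u i] by (intro adjoin_least G is_subfield_tower K) blast+
    then show ?case by (simp only: tower.simps(2)[of K _ "Suc i"])
  qed
  have "\<exists>i. algebraic_over (?G i) (u i)"
  proof (cases n)
    case 0
    then have "algebraic_over K (1 * w + f)" using alg by (simp add: w_def)
    then have "algebraic_over K w"
      by (rule algebraic_over_affine[OF K]) (use f is_subfield_1[OF K] in auto)
    with w_tr show ?thesis by simp
  next
    case (Suc i)
    obtain v where v: "v \<in> ?G i" "(D ^^ Suc i) z = w * u i + v" using zu by blast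
    have "algebraic_over (?G i) (w * u i + v)"
      using algebraic_over_mono[OF FG[of i]] alg unfolding Suc v(2) by blast
    then have "algebraic_over (?G i) (u i)"
      by (rule algebraic_over_affine[OF G]) (use w(1) v(1) K1G wK1 in auto)
    then show ?thesis by blast
  qed
  then obtain i where i: "algebraic_over (?G i) (u i)" by blast
  have \<sigma>K1: "\<sigma> x \<in> K1" if "x \<in> K1" for x
    using that unfolding K1_def
    by (rule hom_adjoin[OF K is_subfield_adjoin[OF K], rotated 2])
       (use w(2) \<sigma>K a K1 KK1 wK1 in \<open>auto simp: K1_def[symmetric] intro: is_subfield_mult\<close>)
  obtain N C f1 where f1: "f1 \<in> K1" "\<forall>i<N. \<sigma> (C i) = C i"
    "\<sigma> f1 = 1 * f1 + (\<delta> N - (\<Sum>i<N. C i * \<delta> i))"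
    using linear_relation[OF K1 \<sigma>K1 KK1[OF fixK] is_subfield_1[OF K1] one_neq_zero KK1[OF \<delta>K] u i]
    by blast
  define \<gamma> where "\<gamma> = \<delta> N - (\<Sum>i<N. C i * \<delta> i)"
  have \<gamma>: "\<gamma> \<in> K" unfolding \<gamma>_def using f1(2) fixK
    by (intro is_subfield_minus is_subfield_sum is_subfield_mult \<delta>K K) auto
  have f1': "f1 \<in> adjoin K w" "\<sigma> f1 = 1 * f1 + poly [:\<gamma>:] w" using f1 by (auto simp: K1_def \<gamma>_def)
  obtain p q where pq: "p \<in> polys_over K" "q \<in> polys_over K" "lead_coeff q = 1" "poly q w \<noteq> 0"
    "f1 = poly p w / poly q w" "twist a 0 q = smult (a ^ degree q) q"
    using minimal_denominator[OF K \<sigma>K a is_subfield_0[OF K] w(2) f1' is_subfield_1[OF K]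
        one_neq_zero polys_over_const[OF K \<gamma>] w_tr] by metis
  define e where "e = degree q"
  \<comment> \<open>A nonzero coefficient of index i below the degree would be a semi-invariant with
    exponent \<open>e - i\<close>. Hence the monic denominator is the power
    \<open>w ^ e\<close>.\<close>
  have "coeff q i = 0" if "i < e" for i
  proof (rule ccontr)
    assume nz: "coeff q i \<noteq> 0"
    have "a ^ i * \<sigma> (coeff q i) = a ^ e * coeff q i"
      using arg_cong[OF pq(6), of "\<lambda>p. coeff p i"] by (simp add: coeff_twist_0 e_def)
    also have "a ^ e = a ^ i * a ^ (e - i)" using that by (simp flip: power_add)
    finally have "\<sigma> (coeff q i) = a ^ (e - i) * coeff q i" using a by simp
    then show False using no_semi_invariant[OF polys_over_coeff[OF pq(2)] nz, of "e - i"] that by simp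
  qed
  then have "coeff q i = coeff (monom 1 e) i" for i
    using pq(3) by (cases i e rule: linorder_cases) (auto simp: e_def coeff_eq_0)
  then have "q = monom 1 e" by (rule poly_eqI)
  then have qw: "poly q w = w ^ e" by (simp add: poly_monom)
  \<comment> \<open>Over the denominator \<open>w ^ e\<close>, the coefficient of index e in the
    numerator is the part of f1 of degree 0 in w. It lies in K and inherits the equation of
    f1.\<close>
  have "twist a 0 p = smult (a ^ e) (p + monom \<gamma> e)"
  proof (rule transcendental_poly_eqD[OF K w_tr])
    have "poly p w = f1 * w ^ e" using pq(4,5) qw by simp
    moreover have "\<sigma> (f1 * w ^ e) = a ^ e * (f1 * w ^ e + \<gamma> * w ^ e)"
      using f1'(2) w(2) by (simp add: hom_mult hom_power power_mult_distrib algebra_simps)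
    ultimately show "poly (twist a 0 p) w = poly (smult (a ^ e) (p + monom \<gamma> e)) w"
      by (simp add: poly_twist[OF w(2)] poly_monom)
    show "twist a 0 p \<in> polys_over K"
      by (rule twist_polys_over[OF K \<sigma>K a(1) is_subfield_0[OF K] pq(1)])
  qed (intro polys_over_intros K is_subfield_power a pq \<gamma>)
  from arg_cong[OF this, of "\<lambda>p. coeff p e"] have "\<sigma> (coeff p e) = coeff p e + \<gamma>"
    using a by (simp add: coeff_twist_0)
  then show False
    using no_telescoper[OF polys_over_coeff[OF pq(1)], of N C e] f1(2) by (simp add: \<gamma>_def \<delta>_def)
qed

text \<open>Here the equations of the derivatives have inhomogeneous terms involving lower
  derivatives. Both obstructions extend from K to the tower below the least solvable level, where
  the coefficients of a solution would contradict them.\<close>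

lemma not_algebraic_over_tower: "\<not> algebraic_over (tower K (\<lambda>i. (D ^^ i) z) n) ((D ^^ n) z)"
proof
  assume alg: "algebraic_over (tower K (\<lambda>i. (D ^^ i) z) n) ((D ^^ n) z)"
  define Z where "Z = (\<lambda>i. (D ^^ i) z)"
  define \<beta> where "\<beta> = (\<lambda>i. \<sigma> (Z i) - a * Z i)"
  let ?F = "tower K Z"
  note F = is_subfield_tower[OF K, of Z]
  have KF: "x \<in> ?F n" if "x \<in> K" for x n using base_subset_tower[OF K, of Z n] that by blast
  have Zeq: "\<sigma> (Z i) = a * Z i + \<beta> i" for i by (simp add: \<beta>_def)
  have DZ: "D (Z i) = Z (Suc i)" for i by (simp add: Z_def)
  have ZF: "Z i \<in> ?F n" if "i < n" for i n using that by (rule gen_in_tower[OF K])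
  have DF: "D x \<in> ?F (Suc n)" if "x \<in> ?F n" for x n
    by (rule D_tower[OF K _ _ that])
       (use DK KF ZF DZ in \<open>auto simp del: tower.simps\<close>)
  have \<beta>0: "\<beta> 0 = b" using z by (simp add: \<beta>_def Z_def)
  have \<beta>Suc: "\<beta> (Suc i) = D a * Z i + D (\<beta> i)" for i
    by (simp add: \<beta>_def D_diff D_mult D_hom DZ)
  \<comment> \<open>By the Leibniz rule the inhomogeneous term at level i + 1 is linear in the last
    available derivative Z_i, with the factor (i + 1) D a, up to an element not involving
    Z_i.\<close>
  have \<beta>F: "\<exists>\<phi>\<in>?F i. \<beta> (Suc i) = of_nat (Suc i) * D a * Z i + \<phi>" for i
  proof (induction i)
    case 0
    have "D b \<in> ?F 0" using b DK by simp
    then show ?case by (intro bexI[of _ "D b"]) (auto simp: \<beta>Suc \<beta>0)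
  next
    case (Suc i)
    then obtain \<phi> where \<phi>: "\<phi> \<in> ?F i" "\<beta> (Suc i) = of_nat (Suc i) * D a * Z i + \<phi>" by blast
    have "\<beta> (Suc (Suc i)) = of_nat (Suc (Suc i)) * D a * Z (Suc i) +
        (of_nat (Suc i) * D (D a) * Z i + D \<phi>)"
      unfolding \<beta>Suc[of "Suc i"] \<phi>(2) D_add D_mult DZ D_of_nat by (simp add: algebra_simps)
    moreover have "of_nat (Suc i) * D (D a) * Z i + D \<phi> \<in> ?F (Suc i)"
      by (intro is_subfield_add is_subfield_mult is_subfield_of_nat F KF[OF DK[OF DK[OF a(1)]]]
          ZF DF \<phi>) auto
    ultimately show ?case by blast
  qed
  have \<beta>mem: "\<beta> i \<in> ?F i" for i
  proof (cases i)
    case (Suc j)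
    obtain \<phi> where \<phi>: "\<phi> \<in> ?F j" "\<beta> (Suc j) = of_nat (Suc j) * D a * Z j + \<phi>" using \<beta>F by blast
    show ?thesis unfolding Suc \<phi>(2) using \<phi>(1) tower_Suc_subset[OF K, of Z j]
      by (intro is_subfield_add is_subfield_mult is_subfield_of_nat F KF[OF DK[OF a(1)]] ZF) auto
  qed (use \<beta>0 b in simp)
  have \<sigma>F: "\<sigma> x \<in> ?F n" if "x \<in> ?F n" for x n
  proof (rule hom_tower[OF K \<sigma>K _ that])
    show "\<sigma> (Z i) \<in> ?F (Suc i)" for i
      unfolding Zeq using \<beta>mem[of i] tower_Suc_subset[OF K, of Z i]
      by (intro is_subfield_add is_subfield_mult F KF[OF a(1)] ZF) auto
  qed
  define n' where "n' = (LEAST n. algebraic_over (?F n) (Z n))"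
  have n': "algebraic_over (?F n') (Z n')"
    unfolding n'_def Z_def using alg by (rule LeastI)
  have tr: "\<not> algebraic_over (?F i) (Z i)" if "i < n'" for i
    using not_less_Least[of i "\<lambda>n. algebraic_over (?F n) (Z n)"] that by (simp add: n'_def)
  define Q where "Q = (\<lambda>m. \<exists>g\<in>?F m. \<sigma> g = a * g + \<beta> m)"
  have "Q n'" unfolding Q_def by (rule algebraic_solution[OF F \<sigma>F KF[OF a(1)] a(2) \<beta>mem Zeq n'])
  define m where "m = (LEAST m. Q m)"
  have "Q m" unfolding m_def using \<open>Q n'\<close> by (rule LeastI)
  have "m \<le> n'" unfolding m_def using \<open>Q n'\<close> by (rule Least_le)
  have no: "\<not> (\<exists>g\<in>?F i. \<sigma> g = a * g + \<beta> i)" if "i < m" for i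
    using not_less_Least[of i Q] that by (simp add: m_def Q_def)
  \<comment> \<open>The first obstruction climbs the tower: a semi-invariant is a polynomial in the
    top generator, and positive degree would solve the equation of that generator, against the
    choice of m.\<close>
  have semi: False if "j \<le> m" "y \<in> ?F j" "y \<noteq> 0" "e > 0" "\<sigma> y = a ^ e * y" for j y e
    using that
  proof (induction j arbitrary: y)
    case 0
    then show ?case using no_semi_invariant by simp
  next
    case (Suc j)
    have j: "j < m" "j < n'" using Suc.prems(1) \<open>m \<le> n'\<close> by auto
    have y: "y \<in> adjoin (?F j) (Z j)" "\<sigma> y = a ^ e * y + poly 0 (Z j)" using Suc.prems by auto
    have ae: "a ^ e \<in> ?F j" "a ^ e \<noteq> 0" using a KF K by (auto intro: is_subfield_power)
    obtain p where p: "p \<in> polys_over (?F j)" "y = poly p (Z j)"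
      "twist a (\<beta> j) p = smult (a ^ e) p + 0"
      using polynomial_solution[OF F \<sigma>F KF[OF a(1)] a(2) \<beta>mem Zeq y ae polys_over_0[OF F]
          tr[OF j(2)] no[OF j(1)]] by blast
    have "degree p = 0"
    proof (rule ccontr)
      assume "degree p \<noteq> 0"
      then obtain d where d: "degree p = Suc d" by (cases "degree p") auto
      show False
        using solution_from_twist_eigenvector[OF F a(2) ae(2) p(1) d p(3)] no[OF j(1)] by simp
    qed
    then obtain x where "p = [:x:]" by (rule degree_eq_zeroE)
    then have "y \<in> ?F j" using p polys_over_coeff[OF p(1), of 0] by simp
    then show ?case using Suc j by simp
  qed
  \<comment> \<open>The reciprocal form is the equation that leading coefficients satisfy in the
    comparisons below.\<close>
  have semi': False if "j \<le> m" "x \<in> ?F j" "x \<noteq> 0" "e > 0" "a ^ e * \<sigma> x = x" for j x e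
  proof (rule semi[OF that(1) _ _ that(4)])
    show "inverse x \<in> ?F j" "inverse x \<noteq> 0" using that F by (auto intro: is_subfield_inverse)
    have "inverse x = inverse (a ^ e) * inverse (\<sigma> x)"
      using that(5) by (metis inverse_mult_distrib)
    then have "a ^ e * inverse x = inverse (\<sigma> x)" using a by (simp flip: mult.assoc)
    then show "\<sigma> (inverse x) = a ^ e * inverse x" by (simp only: hom_inverse)
  qed
  define \<delta> where "\<delta> = D a / a"
  have \<delta>K: "\<delta> \<in> K" unfolding \<delta>_def using a DK K by (intro is_subfield_divide) auto
  \<comment> \<open>At the bottom this is the second obstruction for the operator of order 0. Higher
    up, a leading coefficient in positive degree would satisfy the excluded reciprocal
    equation.\<close>
  have log: False if "j \<le> m" "h \<in> ?F j" "\<sigma> h = h + \<delta>" for j h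
    using that
  proof (induction j arbitrary: h)
    case 0
    then show ?case using no_telescoper[of h 0] by (simp add: \<delta>_def)
  next
    case (Suc j)
    have j: "j < m" "j < n'" using Suc.prems(1) \<open>m \<le> n'\<close> by auto
    have h: "h \<in> adjoin (?F j) (Z j)" "\<sigma> h = 1 * h + poly [:\<delta>:] (Z j)" using Suc.prems by auto
    obtain p where p: "p \<in> polys_over (?F j)" "h = poly p (Z j)"
      "twist a (\<beta> j) p = smult 1 p + [:\<delta>:]"
      using polynomial_solution[OF F \<sigma>F KF[OF a(1)] a(2) \<beta>mem Zeq h is_subfield_1[OF F]
          one_neq_zero polys_over_const[OF F KF[OF \<delta>K]] tr[OF j(2)] no[OF j(1)]] by blast
    have "degree p = 0"
    proof (rule ccontr)
      assume "degree p \<noteq> 0"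
      then obtain d where d: "degree p = Suc d" by (cases "degree p") auto
      have "a ^ Suc d * \<sigma> (coeff p (Suc d)) = coeff p (Suc d)"
        using arg_cong[OF p(3), of "\<lambda>p. coeff p (Suc d)"] coeff_twist(1)[of p d a "\<beta> j"] d by simp
      moreover have "coeff p (Suc d) \<noteq> 0"
        using d by (metis leading_coeff_0_iff degree_0 nat.simps(3))
      ultimately show False
        using semi'[of j "coeff p (Suc d)" "Suc d"] polys_over_coeff[OF p(1)] j by simp
    qed
    then obtain x where "p = [:x:]" by (rule degree_eq_zeroE)
    then have "h \<in> ?F j" using p polys_over_coeff[OF p(1), of 0] by simp
    then show ?case using Suc j by simp
  qed
  obtain g where g: "g \<in> ?F m" "\<sigma> g = a * g + \<beta> m" using \<open>Q m\<close> by (auto simp: Q_def)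
  show False
  proof (cases m)
    case 0
    then show False using homogeneous_case[of g] g alg \<beta>0 by simp
  next
    case (Suc j)
    have j: "j < m" "j < n'" using Suc \<open>m \<le> n'\<close> by auto
    obtain \<phi> where \<phi>: "\<phi> \<in> ?F j" "\<beta> m = of_nat m * D a * Z j + \<phi>" using \<beta>F[of j] Suc by blast
    \<comment> \<open>With m = j + 1, the term \<open>\<beta> m\<close> is a polynomial of degree at
      most 1 in Z_j, so the solution g can be compared with it coefficientwise.\<close>
    define \<gamma> where "\<gamma> = [:\<phi>, of_nat m * D a:]"
    have \<gamma>: "\<gamma> \<in> polys_over (?F j)" unfolding \<gamma>_def
      by (intro polys_over_intros F \<phi> is_subfield_mult is_subfield_of_nat KF[OF DK[OF a(1)]])
    have g': "g \<in> adjoin (?F j) (Z j)" "\<sigma> g = a * g + poly \<gamma> (Z j)"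
      using g Suc \<phi> by (auto simp: \<gamma>_def algebra_simps)
    obtain p where p: "p \<in> polys_over (?F j)" "g = poly p (Z j)"
      "twist a (\<beta> j) p = smult a p + \<gamma>"
      using polynomial_solution[OF F \<sigma>F KF[OF a(1)] a(2) \<beta>mem Zeq g' KF[OF a(1)] a(2) \<gamma>
          tr[OF j(2)] no[OF j(1)]] by blast
    have deg: "degree p \<le> Suc 0"
    proof (rule ccontr)
      assume "\<not> ?thesis"
      then obtain d where d: "degree p = Suc (Suc d)"
        by (metis Suc_le_D not_less_eq_eq)
      let ?x = "coeff p (Suc (Suc d))"
      have "a ^ Suc (Suc d) * \<sigma> ?x = a * ?x"
        using arg_cong[OF p(3), of "\<lambda>p. coeff p (Suc (Suc d))"]
          coeff_twist(1)[of p "Suc d" a "\<beta> j"] d by (simp add: \<gamma>_def)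
        then have "a ^ Suc d * \<sigma> ?x = ?x" using a by (simp add: mult.assoc)
      moreover have "?x \<noteq> 0"
        using d by (metis leading_coeff_0_iff degree_0 nat.simps(3))
      ultimately show False
        using semi'[of j ?x "Suc d"] polys_over_coeff[OF p(1)] j by simp
    qed
    \<comment> \<open>For the linear coefficient u of p the comparison reads a \<sigma>(u) = a u + m
      D a. Dividing by m a gives \<sigma>(h) = h + D a / a, which is excluded by
      \<open>log\<close>.\<close>
    define h where "h = coeff p (Suc 0) / of_nat m"
    have m0: "(of_nat m :: 'a) \<noteq> 0" using j by simp
    have "a * \<sigma> (coeff p (Suc 0)) = a * coeff p (Suc 0) + of_nat m * D a"
      using arg_cong[OF p(3), of "\<lambda>p. coeff p (Suc 0)"] coeff_twist(1)[OF deg, of a "\<beta> j"]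
      by (simp add: \<gamma>_def)
    then have "\<sigma> (coeff p (Suc 0)) = coeff p (Suc 0) + of_nat m * \<delta>"
      using a by (simp add: \<delta>_def field_simps)
    then have "\<sigma> h = h + \<delta>" using m0 by (simp add: h_def hom_divide add_divide_distrib)
    moreover have "h \<in> ?F j"
      unfolding h_def using polys_over_coeff[OF p(1)] F
      by (intro is_subfield_divide is_subfield_of_nat)
    ultimately show False using log[of j h] j by simp
  qed
qed

end

end

section \<open>Local behaviour of meromorphic functions\<close>

lemma mero_const_add: "mero_const (c + d) = mero_const c + mero_const d"
  by transfer (auto intro!: mero_relI' meromorphic_intros)

lemma mero_const_diff: "mero_const (c - d) = mero_const c - mero_const d"
  by transfer (auto intro!: mero_relI' meromorphic_intros)

lemma mero_const_mult: "mero_const (c * d) = mero_const c * mero_const d"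
  by transfer (auto intro!: mero_relI' meromorphic_intros)

lemma mero_const_inverse: "mero_const (inverse c) = inverse (mero_const c)"
  by transfer (auto intro!: mero_relI' meromorphic_intros)

lemma mero_const_0 [simp]: "mero_const 0 = 0"
  by transfer (auto intro!: mero_relI' meromorphic_intros)

lemma mero_const_1 [simp]: "mero_const 1 = 1"
  by transfer (auto intro!: mero_relI' meromorphic_intros)

lemma mero_const_eq_iff [simp]: "mero_const c = mero_const d \<longleftrightarrow> c = d"
proof
  assume "mero_const c = mero_const d"
  then show "c = d" by transfer (auto simp: mero_rel_def)
qed auto

lemma mero_const_eq_0_iff [simp]: "mero_const c = 0 \<longleftrightarrow> c = 0"
  using mero_const_eq_iff[of c 0] by (simp del: mero_const_eq_iff)

lemma mero_const_of_nat: "mero_const (of_nat n) = of_nat n"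
  by (induction n) (auto simp: mero_const_add)

instance mero :: field_char_0
proof
  show "inj (of_nat :: nat \<Rightarrow> mero)"
    by (rule injI) (simp flip: mero_const_of_nat)
qed

lemma mero_shift_const [simp]: "mero_shift (mero_const c) = mero_const c"
  by transfer (auto intro!: mero_relI' meromorphic_intros)

lemma mero_shift_x: "mero_shift mero_x = mero_x + 1"
  by transfer (auto intro!: mero_relI' meromorphic_intros)

lemma mero_deriv_const [simp]: "mero_deriv (mero_const c) = 0"
  by transfer (auto intro!: mero_relI' meromorphic_intros)

lemma mero_deriv_x: "mero_deriv mero_x = 1"
  by transfer (auto intro!: mero_relI' meromorphic_intros)

lemma mero_rel_eventually_analytic:
  "mero_rel f f \<Longrightarrow> eventually (\<lambda>z. f analytic_on {z}) (cosparse UNIV)"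
  by (rule meromorphic_on_imp_analytic_cosparse) (simp add: mero_rel_def)

lemma mero_deriv_add: "mero_deriv (f + g) = mero_deriv f + mero_deriv g"
proof transfer
  fix f g assume fg: "mero_rel f f" "mero_rel g g"
  have "eventually (\<lambda>z. deriv (\<lambda>w. f w + g w) z = deriv f z + deriv g z) (cosparse UNIV)"
    using mero_rel_eventually_analytic[OF fg(1)] mero_rel_eventually_analytic[OF fg(2)]
  proof eventually_elim
    case (elim z)
    then have "f field_differentiable at z" "g field_differentiable at z"
      by (auto intro: analytic_on_imp_differentiable_at)
    then show ?case by simp
  qed
  then show "mero_rel (deriv (\<lambda>z. f z + g z)) (\<lambda>z. deriv f z + deriv g z)"
    using fg by (intro mero_relI meromorphic_intros) (auto simp: mero_rel_def)
qed

lemma mero_deriv_mult: "mero_deriv (f * g) = mero_deriv f * g + f * mero_deriv g"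
proof transfer
  fix f g assume fg: "mero_rel f f" "mero_rel g g"
  have "eventually (\<lambda>z. deriv (\<lambda>w. f w * g w) z = deriv f z * g z + f z * deriv g z) (cosparse UNIV)"
    using mero_rel_eventually_analytic[OF fg(1)] mero_rel_eventually_analytic[OF fg(2)]
  proof eventually_elim
    case (elim z)
    then have "f field_differentiable at z" "g field_differentiable at z"
      by (auto intro: analytic_on_imp_differentiable_at)
    then show ?case by simp
  qed
  then show "mero_rel (deriv (\<lambda>z. f z * g z)) (\<lambda>z. deriv f z * g z + f z * deriv g z)"
    using fg by (intro mero_relI meromorphic_intros) (auto simp: mero_rel_def)
qed

lemma mero_deriv_shift: "mero_deriv (mero_shift f) = mero_shift (mero_deriv f)"
proof transfer
  fix f assume f: "mero_rel f f"
  have "deriv (\<lambda>z. f (z + 1)) = (\<lambda>z. deriv f (z + 1))"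
    by (simp add: deriv_def fun_eq_iff DERIV_shift)
  moreover have "(\<lambda>z. deriv f (z + 1)) meromorphic_on UNIV"
    using f by (intro meromorphic_on_compose[of "deriv f" UNIV "\<lambda>z. z + 1"])
      (auto intro!: analytic_intros meromorphic_intros simp: mero_rel_def)
  ultimately show "mero_rel (deriv (\<lambda>z. f (z + 1))) (\<lambda>z. deriv f (z + 1))"
    by (intro mero_relI') auto
qed

interpretation mero: diff_field_endo mero_shift mero_deriv
proof
  show "mero_shift (x + y) = mero_shift x + mero_shift y" for x y
    by transfer (use mero_shift.rsp in \<open>auto intro!: mero_relI' simp: rel_fun_def mero_rel_def
      intro!: meromorphic_intros meromorphic_on_compose[of _ UNIV "\<lambda>z. z + 1"] analytic_intros\<close>)
  show "mero_shift (x * y) = mero_shift x * mero_shift y" for x y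
    by transfer (use mero_shift.rsp in \<open>auto intro!: mero_relI' simp: rel_fun_def mero_rel_def
      intro!: meromorphic_intros meromorphic_on_compose[of _ UNIV "\<lambda>z. z + 1"] analytic_intros\<close>)
  show "mero_shift 1 = 1"
    using mero_shift_const[of 1] by simp
qed (rule mero_deriv_add mero_deriv_mult mero_deriv_shift)+

text \<open>Representatives agree only off a sparse set, so values at a point do not descend to the
  quotient, whereas punctured limits do.\<close>

lift_definition mero_tendsto :: "mero \<Rightarrow> complex \<Rightarrow> complex \<Rightarrow> bool" is "\<lambda>f y c. (f \<longlongrightarrow> c) (at y)"
  by (intro ext tendsto_cong mero_rel_eventually_at)

lemma mero_tendsto_unique: "mero_tendsto f y c \<Longrightarrow> mero_tendsto f y d \<Longrightarrow> c = d"
  by transfer (rule tendsto_unique[OF at_neq_bot])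

lemma mero_tendsto_add:
  "mero_tendsto f y c \<Longrightarrow> mero_tendsto g y d \<Longrightarrow> mero_tendsto (f + g) y (c + d)"
  by transfer (rule tendsto_add)

lemma mero_tendsto_diff:
  "mero_tendsto f y c \<Longrightarrow> mero_tendsto g y d \<Longrightarrow> mero_tendsto (f - g) y (c - d)"
  by transfer (rule tendsto_diff)

lemma mero_tendsto_mult:
  "mero_tendsto f y c \<Longrightarrow> mero_tendsto g y d \<Longrightarrow> mero_tendsto (f * g) y (c * d)"
  by transfer (rule tendsto_mult)

lemma mero_tendsto_divide:
  "mero_tendsto f y c \<Longrightarrow> mero_tendsto g y d \<Longrightarrow> d \<noteq> 0 \<Longrightarrow> mero_tendsto (f / g) y (c / d)"
  by transfer (rule tendsto_divide)

lemma mero_tendsto_const: "mero_tendsto (mero_const c) y c"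
  by transfer (rule tendsto_const)

lemma mero_tendsto_0 [simp]: "mero_tendsto 0 y 0"
  using mero_tendsto_const[of 0 y] by simp

lemma mero_tendsto_x: "mero_tendsto mero_x y y"
  by transfer (rule tendsto_ident_at)

lemma mero_tendsto_sum:
  "(\<And>i. i \<in> A \<Longrightarrow> mero_tendsto (f i) y (c i)) \<Longrightarrow> mero_tendsto (sum f A) y (sum c A)"
  by (induction A rule: infinite_finite_induct) (auto intro: mero_tendsto_add)

lemma mero_tendsto_shift: "mero_tendsto (mero_shift f) y c \<longleftrightarrow> mero_tendsto f (y + 1) c"
proof transfer
  show "((\<lambda>z. f (z + 1)) \<longlongrightarrow> c) (at y) \<longleftrightarrow> (f \<longlongrightarrow> c) (at (y + 1))" for f :: "complex \<Rightarrow> complex" and y c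
    by (simp add: at_to_0[of y] at_to_0[of "y + 1"] filterlim_filtermap add.assoc)
qed

text \<open>A finite limit means a removable singularity; the derivative of the extended function is
  continuous and agrees with the given one nearby.\<close>

lemma mero_tendsto_deriv:
  assumes "mero_tendsto f y c"
  shows "\<exists>d. mero_tendsto (mero_deriv f) y d"
  using assms
proof transfer
  fix f y c assume f: "mero_rel f f" "(f \<longlongrightarrow> c) (at y)"
  have sing: "isolated_singularity_at f y"
    using f(1)
    by (auto simp: mero_rel_def
        intro: meromorphic_on_isolated_singularity[OF meromorphic_on_subset[of f UNIV]])
  have ana: "remove_sings f analytic_on {y}"
    by (rule remove_sings_analytic_at[OF sing f(2)])
  have "eventually (\<lambda>w. deriv (remove_sings f) w = deriv f w) (at y)"
  proof -
    have "eventually (\<lambda>w. f analytic_on {w}) (at y)"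
      using mero_rel_eventually_analytic[OF f(1)] by (rule eventually_cosparse_imp_eventually_at) auto
    then show ?thesis by eventually_elim simp
  qed
  moreover have "(deriv (remove_sings f) \<longlongrightarrow> deriv (remove_sings f) y) (at y)"
    using analytic_deriv[OF ana] by (meson analytic_at_imp_isCont isContD)
  ultimately show "\<exists>d. (deriv f \<longlongrightarrow> d) (at y)"
    using tendsto_cong by blast
qed

lemma countable_mero_no_limit: "countable {y. \<not> (\<exists>c. mero_tendsto f y c)}"
proof transfer
  fix f assume f: "mero_rel f f"
  have "eventually (\<lambda>y. \<exists>c. (f \<longlongrightarrow> c) (at y)) (cosparse UNIV)"
    using mero_rel_eventually_analytic[OF f]
    by eventually_elim (meson analytic_at_imp_isCont isContD)
  then show "countable {y. \<not> (\<exists>c. (f \<longlongrightarrow> c) (at y))}"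
    using sparse_imp_countable[OF open_UNIV] by (simp add: eventually_cosparse)
qed

text \<open>Where both f and 1/f have limits, these multiply to 1, so the limit of f is nonzero
  there.\<close>

lemma countable_mero_no_nonzero_limit:
  assumes "f \<noteq> 0"
  shows "countable {y. \<not> (\<exists>c. c \<noteq> 0 \<and> mero_tendsto f y c)}"
proof -
  have "{y. \<not> (\<exists>c. c \<noteq> 0 \<and> mero_tendsto f y c)} \<subseteq>
      {y. \<not> (\<exists>c. mero_tendsto f y c)} \<union> {y. \<not> (\<exists>c. mero_tendsto (1 / f) y c)}"
  proof safe
    fix y c d assume *: "\<nexists>c. c \<noteq> 0 \<and> mero_tendsto f y c" "mero_tendsto f y c" "mero_tendsto (1 / f) y d"
    then have "c = 0" by blast
    with mero_tendsto_mult[OF *(2,3)] assms have "mero_tendsto 1 y 0" by simp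
    with mero_tendsto_unique[OF this mero_tendsto_const[of 1 y, unfolded mero_const_1]] show False by simp
  qed
  then show ?thesis using countable_mero_no_limit countable_Un countable_subset by metis
qed

section \<open>Orders of zeros and poles\<close>

lift_definition mero_lin :: "complex \<Rightarrow> int \<Rightarrow> mero" is "\<lambda>y n z. (z - y) powi n"
  by (auto simp: mero_rel_def intro!: meromorphic_intros)

lemma mero_lin_0 [simp]: "mero_lin y 0 = 1"
  by transfer (auto intro!: mero_relI' meromorphic_intros)

lemma mero_lin_1: "mero_lin y 1 = mero_x - mero_const y"
  by transfer (auto intro!: mero_relI' meromorphic_intros)

text \<open>Laws for integer powers of z - y can fail at y itself, where negative powers take the
  default value 0; a single point is sparse and does not affect the quotient.\<close>

lemma mero_eqI_off_point:
  assumes "f meromorphic_on UNIV" "g meromorphic_on UNIV" "\<And>z. z \<noteq> y \<Longrightarrow> f z = g z"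
  shows "mero_rel f g"
proof (rule mero_relI[OF assms(1,2)])
  have "eventually (\<lambda>z. z \<noteq> y) (at w)" for w
    by (metis UNIV_I eventually_at_filter eventually_neq_at_within eventually_mono)
  then have "eventually (\<lambda>z. z \<noteq> y) (cosparse UNIV)"
    by (simp add: eventually_cosparse_open_eq)
  then show "eventually (\<lambda>z. f z = g z) (cosparse UNIV)"
    by eventually_elim (rule assms(3))
qed

lemma mero_lin_add: "mero_lin y (m + n) = mero_lin y m * mero_lin y n"
proof transfer
  fix y m n
  show "mero_rel (\<lambda>z. (z - y) powi (m + n)) (\<lambda>z. (z - y) powi m * (z - y) powi n)"
    by (rule mero_eqI_off_point[where y = y]) (auto intro!: meromorphic_intros simp: power_int_add)
qed

lemma mero_lin_cancel: "mero_lin y n * mero_lin y (- n) = 1" "mero_lin y (- n) * mero_lin y n = 1"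
  by (simp_all flip: mero_lin_add)

lemma mero_lin_shift: "mero_shift (mero_lin y n) = mero_lin (y - 1) n"
  by transfer (auto intro!: mero_relI' meromorphic_intros simp: algebra_simps)

lemma mero_lin_deriv: "mero_deriv (mero_lin y n) = mero_const (of_int n) * mero_lin y (n - 1)"
proof transfer
  fix y n
  show "mero_rel (deriv (\<lambda>z. (z - y) powi n)) (\<lambda>z. of_int n * (z - y) powi (n - 1))"
  proof (rule mero_eqI_off_point[where y = y])
    fix z assume "z \<noteq> y"
    then show "deriv (\<lambda>z. (z - y) powi n) z = of_int n * (z - y) powi (n - 1)"
      by (intro DERIV_imp_deriv) (auto intro!: derivative_eq_intros)
  qed (auto intro!: meromorphic_intros)
qed

lemma mero_tendsto_lin: "z \<noteq> y \<or> n \<ge> 0 \<Longrightarrow> mero_tendsto (mero_lin y n) z ((z - y) powi n)"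
proof transfer
  fix z y :: complex and n :: int
  assume "z \<noteq> y \<or> n \<ge> 0"
  then show "((\<lambda>z. (z - y) powi n) \<longlongrightarrow> (z - y) powi n) (at z)"
  proof
    assume "n \<ge> 0"
    then show ?thesis by (auto simp: power_int_def intro!: tendsto_intros)
  qed (auto intro!: tendsto_intros)
qed

text \<open>Orders are relations rather than a function because the zero function has none; it
  satisfies \<open>order_ge\<close> for every bound.\<close>

definition has_order :: "mero \<Rightarrow> complex \<Rightarrow> int \<Rightarrow> bool" where
  "has_order f y n \<longleftrightarrow> (\<exists>c. c \<noteq> 0 \<and> mero_tendsto (f * mero_lin y (- n)) y c)"

definition order_ge :: "mero \<Rightarrow> complex \<Rightarrow> int \<Rightarrow> bool" where
  "order_ge f y n \<longleftrightarrow> (\<exists>c. mero_tendsto (f * mero_lin y (- n)) y c)"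

abbreviation regular_at :: "mero \<Rightarrow> complex \<Rightarrow> bool" where
  "regular_at f y \<equiv> order_ge f y 0"

lemma regular_at_iff: "regular_at f y \<longleftrightarrow> (\<exists>c. mero_tendsto f y c)"
  by (simp add: order_ge_def)

lemma has_order_imp_ge: "has_order f y n \<Longrightarrow> order_ge f y n"
  by (auto simp: has_order_def order_ge_def)

lemma order_ge_0 [simp]: "order_ge 0 y n"
  by (auto simp: order_ge_def intro!: exI[of _ 0])

lemma not_has_order_0 [simp]: "\<not> has_order 0 y n"
  using mero_tendsto_unique[OF mero_tendsto_0] by (auto simp: has_order_def)

text \<open>The surplus power of x - y forces the limit 0. Uniqueness of the order and dominance of
  the lowest order in a difference both rest on this.\<close>

lemma order_ge_less_tendsto_0:
  assumes "order_ge f y m" "n < m"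
  shows "mero_tendsto (f * mero_lin y (- n)) y 0"
proof -
  obtain c where c: "mero_tendsto (f * mero_lin y (- m)) y c" using assms by (auto simp: order_ge_def)
  have "mero_tendsto (mero_lin y (m - n)) y 0"
    using mero_tendsto_lin[of y y "m - n"] assms(2) by (simp add: power_int_0_left_if)
  from mero_tendsto_mult[OF c this] show ?thesis
    by (simp add: mult.assoc flip: mero_lin_add)
qed

lemma order_ge_mono: "order_ge f y m \<Longrightarrow> n \<le> m \<Longrightarrow> order_ge f y n"
  using order_ge_less_tendsto_0[of f y m n] by (cases "n = m") (auto simp: order_ge_def)

lemma has_order_ge_imp_le: "has_order f y n \<Longrightarrow> order_ge f y m \<Longrightarrow> m \<le> n"
  using order_ge_less_tendsto_0[of f y m n] mero_tendsto_unique
  by (fastforce simp: has_order_def not_le[symmetric])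

lemma has_order_unique: "has_order f y n \<Longrightarrow> has_order f y m \<Longrightarrow> n = m"
  by (meson has_order_ge_imp_le has_order_imp_ge order_antisym)

lemma has_order_mult:
  assumes "has_order f y m" "has_order g y n"
  shows "has_order (f * g) y (m + n)"
proof -
  obtain c d where "c \<noteq> 0" "mero_tendsto (f * mero_lin y (- m)) y c"
    "d \<noteq> 0" "mero_tendsto (g * mero_lin y (- n)) y d"
    using assms by (auto simp: has_order_def)
  moreover have "f * g * mero_lin y (- (m + n)) = f * mero_lin y (- m) * (g * mero_lin y (- n))"
    using mero_lin_add[of y "-m" "-n"] by (simp add: mult_ac)
  ultimately show ?thesis
    unfolding has_order_def by (metis mero_tendsto_mult mult_eq_0_iff)
qed

lemma order_ge_mult:
  assumes "order_ge f y m" "order_ge g y n"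
  shows "order_ge (f * g) y (m + n)"
proof -
  obtain c d where "mero_tendsto (f * mero_lin y (- m)) y c"
    "mero_tendsto (g * mero_lin y (- n)) y d"
    using assms by (auto simp: order_ge_def)
  moreover have "f * g * mero_lin y (- (m + n)) = f * mero_lin y (- m) * (g * mero_lin y (- n))"
    using mero_lin_add[of y "-m" "-n"] by (simp add: mult_ac)
  ultimately show ?thesis
    unfolding order_ge_def by (metis mero_tendsto_mult)
qed

lemma order_ge_add: "order_ge f y n \<Longrightarrow> order_ge g y n \<Longrightarrow> order_ge (f + g) y n"
  unfolding order_ge_def by (metis distrib_right mero_tendsto_add)

lemma order_ge_const: "regular_at (mero_const c) y"
  using mero_tendsto_const by (auto simp: regular_at_iff)

lemma order_ge_const_mult: "order_ge f y n \<Longrightarrow> order_ge (mero_const c * f) y n"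
  using order_ge_mult[OF order_ge_const[of c y], of f n] by simp

lemma order_ge_sum: "(\<And>i. i \<in> A \<Longrightarrow> order_ge (f i) y n) \<Longrightarrow> order_ge (sum f A) y n"
  by (induction A rule: infinite_finite_induct) (auto intro: order_ge_add)

lemma order_ge_diff: "order_ge f y n \<Longrightarrow> order_ge g y n \<Longrightarrow> order_ge (f - g) y n"
  unfolding order_ge_def by (metis left_diff_distrib mero_tendsto_diff)

lemma has_order_diff:
  assumes "has_order f y n" "order_ge g y m" "n < m"
  shows "has_order (f - g) y n"
proof -
  obtain c where c: "c \<noteq> 0" "mero_tendsto (f * mero_lin y (- n)) y c"
    using assms(1) by (auto simp: has_order_def)
  from mero_tendsto_diff[OF c(2) order_ge_less_tendsto_0[OF assms(2,3)]] c(1) show ?thesis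
    by (auto simp: has_order_def left_diff_distrib)
qed

lemma has_order_shift: "has_order (mero_shift f) y n \<longleftrightarrow> has_order f (y + 1) n"
  using mero_tendsto_shift[of "f * mero_lin (y + 1) (- n)" y]
  by (simp add: has_order_def mero.hom_mult mero_lin_shift)

lemma regular_at_shift: "regular_at (mero_shift f) y \<longleftrightarrow> regular_at f (y + 1)"
  by (simp add: regular_at_iff mero_tendsto_shift)

text \<open>Differentiating f = u (x - y)^n, the term with u' keeps an extra factor x - y and
  vanishes in the limit. The leading coefficient is multiplied by n, so a nonzero order drops by
  exactly one.\<close>

lemma tendsto_deriv_factor:
  assumes "mero_tendsto (f * mero_lin y (- n)) y c"
  shows "mero_tendsto (mero_deriv f * mero_lin y (- (n - 1))) y (of_int n * c)"
proof -
  define u where "u = f * mero_lin y (- n)"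
  obtain d where d: "mero_tendsto (mero_deriv u) y d" using mero_tendsto_deriv assms u_def by blast
  have f: "f = u * mero_lin y n" by (simp add: u_def mult.assoc mero_lin_cancel)
  have "mero_deriv f * mero_lin y (- (n - 1)) =
      mero_deriv u * (mero_lin y n * mero_lin y (1 - n)) +
      u * (mero_const (of_int n) * (mero_lin y (n - 1) * mero_lin y (- (n - 1))))"
    by (simp add: f mero_deriv_mult mero_lin_deriv algebra_simps)
  also have "\<dots> = mero_deriv u * mero_lin y 1 + u * mero_const (of_int n)"
    unfolding mero_lin_cancel by (simp flip: mero_lin_add)
  finally have *: "mero_deriv f * mero_lin y (- (n - 1)) =
    mero_deriv u * mero_lin y 1 + u * mero_const (of_int n)" .
  have "mero_tendsto (mero_lin y 1) y 0" using mero_tendsto_lin[of y y 1] by simp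
  from mero_tendsto_add[OF mero_tendsto_mult[OF d this]
      mero_tendsto_mult[OF assms[folded u_def] mero_tendsto_const[of "of_int n"]]]
  show ?thesis unfolding * by (simp add: mult.commute)
qed

lemma has_order_deriv: "has_order f y n \<Longrightarrow> n \<noteq> 0 \<Longrightarrow> has_order (mero_deriv f) y (n - 1)"
  using tendsto_deriv_factor unfolding has_order_def by (metis mult_eq_0_iff of_int_eq_0_iff)

lemma regular_at_deriv: "regular_at f y \<Longrightarrow> regular_at (mero_deriv f) y"
  using mero_tendsto_deriv by (auto simp: regular_at_iff)

lemma regular_at_deriv_iter: "regular_at f y \<Longrightarrow> regular_at ((mero_deriv ^^ n) f) y"
  by (induction n) (auto intro: regular_at_deriv)

lemma has_order_deriv_iter:
  assumes "has_order f y m" "m < 0"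
  shows "has_order ((mero_deriv ^^ n) f) y (m - int n)"
proof (induction n)
  case (Suc n)
  then have "has_order (mero_deriv ((mero_deriv ^^ n) f)) y (m - int n - 1)"
    using assms(2) by (intro has_order_deriv) auto
  then show ?case by (simp add: algebra_simps)
qed (use assms in auto)

lemma ex_has_order:
  assumes "f \<noteq> 0"
  shows "\<exists>n. has_order f y n"
  using assms unfolding has_order_def
proof transfer
  fix f y assume f: "mero_rel f f" "\<not> mero_rel f (\<lambda>_. 0)"
  then have m: "f meromorphic_on UNIV" by (simp add: mero_rel_def)
  have y: "f meromorphic_on {y}" by (rule meromorphic_on_subset[OF m]) auto
  have ev: "eventually (\<lambda>z. f z \<noteq> 0) (at y)"
    using mero_rel_nonzero[OF m f(2)] by (rule eventually_cosparse_imp_eventually_at) auto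
  define n g where "n = zorder f y" and "g = zor_poly f y"
  obtain r where r: "g y \<noteq> 0" "r > 0" "g holomorphic_on cball y r"
    "\<And>w. w \<in> cball y r - {y} \<Longrightarrow> f w = g w * (w - y) powi n"
    using zorder_exist[OF meromorphic_on_isolated_singularity[OF y] meromorphic_on_not_essential[OF y]]
      eventually_frequently[OF _ ev] by (auto simp: n_def g_def)
  have "isCont g y"
    using r(2) by (intro continuous_on_interior[OF holomorphic_on_imp_continuous_on[OF r(3)]]) simp
  then have "(g \<longlongrightarrow> g y) (at y)" by (rule isContD)
  moreover have "eventually (\<lambda>w. w \<in> ball y r - {y}) (at y)"
    using r(2) by (intro eventually_at_in_open) auto
  then have "eventually (\<lambda>w. g w = f w * (w - y) powi (- n)) (at y)"
    by eventually_elim (use r(4) in \<open>simp add: power_int_minus\<close>)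
  ultimately have "((\<lambda>w. f w * (w - y) powi (- n)) \<longlongrightarrow> g y) (at y)"
    using tendsto_cong by fastforce
  then show "\<exists>n c. c \<noteq> 0 \<and> ((\<lambda>w. f w * (w - y) powi (- n)) \<longlongrightarrow> c) (at y)"
    using r(1) by blast
qed

lemma regular_at_iff_order: "has_order f y n \<Longrightarrow> regular_at f y \<longleftrightarrow> n \<ge> 0"
  using has_order_ge_imp_le[of f y n 0] has_order_imp_ge[of f y n] order_ge_mono[of f y n 0] by auto

text \<open>Links orders to the predicates in terms of which \<open>standard_form\<close> is
  defined.\<close>

lemma has_order_imp_zero_or_pole:
  assumes "has_order f y n" "n \<noteq> 0"
  shows "mero_zero_at f y \<or> mero_pole_at f y"
  using assms unfolding has_order_def
proof (elim exE conjE, transfer)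
  fix f :: "complex \<Rightarrow> complex" and y n c
  assume n: "n \<noteq> 0" and c: "c \<noteq> 0" and lim: "((\<lambda>z. f z * (z - y) powi (- n)) \<longlongrightarrow> c) (at y)"
  define u where "u = (\<lambda>z. f z * (z - y) powi (- n))"
  have fu: "eventually (\<lambda>z. u z * (z - y) powi n = f z) (at y)"
    using eventually_neq_at_within[of y y UNIV] by eventually_elim (simp add: u_def power_int_minus)
  have u: "(u \<longlongrightarrow> c) (at y)" using lim by (simp add: u_def)
  have u0: "eventually (\<lambda>z. u z \<noteq> 0) (at y)" using tendsto_imp_eventually_ne[OF u c] .
  consider "n > 0" | "n < 0" using n by linarith
  then show "isolated_zero f y \<or> is_pole f y"
  proof cases
    case 1
    have "((\<lambda>z. (z - y) ^ nat n) \<longlongrightarrow> (y - y) ^ nat n) (at y)" by (intro tendsto_intros)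
    from tendsto_mult[OF u this] have "((\<lambda>z. u z * (z - y) powi n) \<longlongrightarrow> 0) (at y)"
      using 1 by (simp add: power_int_def zero_power)
    then have "(f \<longlongrightarrow> 0) (at y)" using tendsto_cong[OF fu] by simp
    moreover have "eventually (\<lambda>z. f z \<noteq> 0) (at y)"
      using fu u0 eventually_neq_at_within[of y y UNIV]
      by eventually_elim (metis mult_eq_0_iff power_int_eq_0_iff right_minus_eq)
    ultimately show ?thesis by (simp add: isolated_zero_def)
  next
    case 2
    have "filterlim (\<lambda>z. (z - y) ^ nat (- n)) (at 0) (at y)"
      using 2 by (auto simp: filterlim_at eventually_at_filter intro!: tendsto_eq_intros)
    from filterlim_divide_at_infinity[OF u this c]
    have "filterlim (\<lambda>z. u z / (z - y) ^ nat (- n)) at_infinity (at y)" .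
    also have "(\<lambda>z. u z / (z - y) ^ nat (- n)) = (\<lambda>z. u z * (z - y) powi n)"
      using 2 by (auto simp: power_int_def divide_inverse power_inverse)
    finally have "is_pole f y"
      unfolding is_pole_def using filterlim_cong[OF refl refl fu] by simp
    then show ?thesis ..
  qed
qed

section \<open>Rational functions\<close>

lemma mero_poly_meromorphic: "poly p meromorphic_on UNIV"
  using poly_holomorphic_on[of "\<lambda>z. z" UNIV p]
  by (intro analytic_on_imp_meromorphic_on) (simp add: analytic_on_open)

lift_definition mero_poly :: "complex poly \<Rightarrow> mero" is poly
  by (auto simp: mero_rel_def mero_poly_meromorphic)

lemma mero_poly_add: "mero_poly (p + q) = mero_poly p + mero_poly q"
  by transfer (auto intro!: mero_relI' meromorphic_intros mero_poly_meromorphic)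

lemma mero_poly_diff: "mero_poly (p - q) = mero_poly p - mero_poly q"
  by transfer (auto intro!: mero_relI' meromorphic_intros mero_poly_meromorphic)

lemma mero_poly_mult: "mero_poly (p * q) = mero_poly p * mero_poly q"
  by transfer (auto intro!: mero_relI' meromorphic_intros mero_poly_meromorphic)

lemma mero_poly_pCons: "mero_poly (pCons c p) = mero_const c + mero_x * mero_poly p"
  by transfer (auto intro!: mero_relI' meromorphic_intros mero_poly_meromorphic)

lemma mero_poly_0 [simp]: "mero_poly 0 = 0"
  using mero_poly_add[of 0 0] by simp

lemma mero_poly_const: "mero_poly [:c:] = mero_const c"
  by (simp add: mero_poly_pCons)

lemma mero_poly_smult: "mero_poly (smult c p) = mero_const c * mero_poly p"
  using mero_poly_mult[of "[:c:]" p] by (simp add: mero_poly_const)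

lemma mero_poly_linear: "mero_poly [:- y, 1:] = mero_lin y 1"
  by (simp add: mero_poly_pCons mero_lin_1 flip: mero_const_diff) (simp add: mero_const_diff[of 0, simplified])

lemma mero_shift_poly: "mero_shift (mero_poly p) = mero_poly (pcompose p [:1, 1:])"
  by (induction p)
     (simp_all add: mero_poly_pCons pcompose_pCons mero_poly_add mero_poly_mult mero.hom_simps
        mero_shift_x mero_poly_const algebra_simps)

lemma mero_tendsto_poly: "mero_tendsto (mero_poly p) y (poly p y)"
  by transfer (auto intro!: tendsto_intros)

lemma mero_poly_eq_0_iff [simp]: "mero_poly p = 0 \<longleftrightarrow> p = 0"
proof
  assume "mero_poly p = 0"
  then have "poly p y = 0" for y
    using mero_tendsto_poly[of p y] mero_tendsto_unique mero_tendsto_0 by metis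
  then show "p = 0" using poly_all_0_iff_0 by blast
qed auto

lemma is_subfield_const_field: "is_subfield const_field"
  unfolding is_subfield_def const_field_def
  by (auto simp flip: mero_const_diff mero_const_mult mero_const_inverse mero_const_1)

lemma is_subfield_rat_field: "is_subfield rat_field"
  unfolding rat_field_def by (rule is_subfield_adjoin[OF is_subfield_const_field])

lemma mero_const_in_rat_field: "mero_const c \<in> rat_field"
  using subset_adjoin[OF is_subfield_const_field] by (auto simp: rat_field_def const_field_def)

lemma mero_x_in_rat_field: "mero_x \<in> rat_field"
  unfolding rat_field_def by (rule gen_in_adjoin[OF is_subfield_const_field])

lemma mero_poly_in_rat_field: "mero_poly p \<in> rat_field"
  by (induction p)
     (auto simp: mero_poly_pCons is_subfield_0[OF is_subfield_rat_field] mero_const_in_rat_field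
        mero_x_in_rat_field intro!: is_subfield_add is_subfield_mult is_subfield_rat_field)

lemma mero_lin_in_rat_field: "mero_lin y n \<in> rat_field"
proof -
  have *: "mero_lin y (int k) \<in> rat_field" for k
  proof (induction k)
    case 0
    then show ?case using is_subfield_1[OF is_subfield_rat_field] by simp
  next
    case (Suc k)
    have "mero_lin y (int (Suc k)) = mero_lin y 1 * mero_lin y (int k)" by (simp flip: mero_lin_add)
    moreover have "mero_lin y 1 \<in> rat_field"
      using mero_poly_in_rat_field[of "[:-y, 1:]"] by (simp add: mero_poly_linear)
    ultimately show ?case using Suc is_subfield_mult[OF is_subfield_rat_field] by simp
  qed
  show ?thesis
  proof (cases n)
    case (neg k)
    have "mero_lin y n = inverse (mero_lin y (int (Suc k)))"
      using mero_lin_cancel(1)[of y n] neg by (metis inverse_unique minus_minus mult.commute)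
    then show ?thesis using *[of "Suc k"] is_subfield_inverse[OF is_subfield_rat_field] by metis
  qed (use * in simp)
qed

lemma mero_shift_rat_field:
  assumes "f \<in> rat_field"
  shows "mero_shift f \<in> rat_field"
proof (rule mero.hom_adjoin[OF is_subfield_const_field is_subfield_rat_field, where t = mero_x])
  show "mero_shift g \<in> rat_field" if "g \<in> const_field" for g
    using that mero_const_in_rat_field by (auto simp: const_field_def)
  show "mero_shift mero_x \<in> rat_field"
    by (simp add: mero_shift_x is_subfield_add is_subfield_1 is_subfield_rat_field mero_x_in_rat_field)
qed (use assms in \<open>simp add: rat_field_def\<close>)

lemma mero_deriv_rat_field:
  assumes "f \<in> rat_field"
  shows "mero_deriv f \<in> rat_field"
proof (rule mero.D_adjoin[OF is_subfield_const_field is_subfield_rat_field, where t = mero_x])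
  show "g \<in> rat_field \<and> mero_deriv g \<in> rat_field" if "g \<in> const_field" for g
    using that mero_const_in_rat_field is_subfield_0[OF is_subfield_rat_field]
    by (auto simp: const_field_def)
qed (use assms is_subfield_1[OF is_subfield_rat_field] in
      \<open>auto simp: rat_field_def[symmetric] mero_deriv_x mero_x_in_rat_field\<close>)

lemma mero_deriv_iter_rat_field: "f \<in> rat_field \<Longrightarrow> (mero_deriv ^^ n) f \<in> rat_field"
  by (induction n) (auto intro: mero_deriv_rat_field)

text \<open>In a representation with denominator of least degree there is no common zero, since the
  corresponding linear factor could be cancelled.\<close>

lemma rat_fieldE:
  assumes "r \<in> rat_field"
  obtains p q where "q \<noteq> 0" "r = mero_poly p / mero_poly q" "\<And>y. poly p y \<noteq> 0 \<or> poly q y \<noteq> 0"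
proof -
  have *: "\<exists>p. poly P mero_x = mero_poly p" if "P \<in> polys_over const_field" for P
    using that
  proof (induction P)
    case 0
    then show ?case by (intro exI[of _ 0]) simp
  next
    case (pCons c P)
    have "c \<in> const_field" "P \<in> polys_over const_field"
      using polys_over_coeff[OF pCons.prems, of 0] polys_over_coeff[OF pCons.prems, of "Suc i" for i]
      by (auto simp: polys_over_def)
    then obtain d p where "c = mero_const d" "poly P mero_x = mero_poly p"
      using pCons.IH by (auto simp: const_field_def)
    then show ?case by (intro exI[of _ "pCons d p"]) (simp add: mero_poly_pCons)
  qed
  define R where "R = (\<lambda>(p, q). q \<noteq> 0 \<and> r = mero_poly p / mero_poly q)"
  obtain P Q where "P \<in> polys_over const_field" "Q \<in> polys_over const_field" "poly Q mero_x \<noteq> 0"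
    "r = poly P mero_x / poly Q mero_x"
    using assms unfolding rat_field_def by (elim adjoinE[OF is_subfield_const_field])
  with *[of P] *[of Q] obtain p0 q0 where "R (p0, q0)" by (auto simp: R_def)
  then obtain pq where pq: "R pq" "\<And>pq'. R pq' \<Longrightarrow> degree (snd pq) \<le> degree (snd pq')"
    using ex_has_least_nat[of R "(p0, q0)" "\<lambda>pq. degree (snd pq)"] by blast
  obtain p q where [simp]: "pq = (p, q)" by (cases pq)
  have q: "q \<noteq> 0" "r = mero_poly p / mero_poly q" using pq(1) by (auto simp: R_def)
  have "poly p y \<noteq> 0 \<or> poly q y \<noteq> 0" for y
  proof (rule ccontr)
    assume "\<not> ?thesis"
    then obtain p1 q1 where 1: "p = [:-y, 1:] * p1" "q = [:-y, 1:] * q1"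
      by (auto simp: poly_eq_0_iff_dvd elim!: dvdE)
    have "q1 \<noteq> 0" using q(1) 1 by auto
    then have "degree q = Suc (degree q1)" unfolding 1 by (subst degree_mult_eq) auto
    moreover have "R (p1, q1)"
      using q \<open>q1 \<noteq> 0\<close> mero_poly_eq_0_iff[of "[:-y, 1:]"]
      by (auto simp: R_def 1 mero_poly_mult simp del: mult_pCons_left)
    ultimately show False using pq(2)[of "(p1, q1)"] by simp
  qed
  with q show ?thesis using that by blast
qed

lemma rat_tendsto:
  "poly q y \<noteq> 0 \<Longrightarrow> mero_tendsto (mero_poly p / mero_poly q) y (poly p y / poly q y)"
  by (intro mero_tendsto_divide mero_tendsto_poly)

lemma finite_rat_order:
  assumes "r \<in> rat_field" "r \<noteq> 0"
  shows "finite {y. \<not> has_order r y 0}"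
proof -
  obtain p q where pq: "q \<noteq> 0" "r = mero_poly p / mero_poly q" using assms(1) by (elim rat_fieldE)
  then have "p \<noteq> 0" using assms(2) by auto
  have "{y. \<not> has_order r y 0} \<subseteq> {y. poly p y = 0} \<union> {y. poly q y = 0}"
  proof
    fix y assume y: "y \<in> {y. \<not> has_order r y 0}"
    have "has_order r y 0" if "poly p y \<noteq> 0" "poly q y \<noteq> 0"
      unfolding has_order_def
      by (intro exI[of _ "poly p y / poly q y"]) (use that rat_tendsto[of q y p] pq(2) in simp)
    with y show "y \<in> {y. poly p y = 0} \<union> {y. poly q y = 0}" by blast
  qed
  then show ?thesis
    using poly_roots_finite[OF \<open>p \<noteq> 0\<close>] poly_roots_finite[OF pq(1)] finite_subset by blast
qed

lemma finite_rat_irregular: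
  assumes "r \<in> rat_field"
  shows "finite {y. \<not> regular_at r y}"
proof (cases "r = 0")
  case False
  have "{y. \<not> regular_at r y} \<subseteq> {y. \<not> has_order r y 0}" using has_order_imp_ge by blast
  then show ?thesis using finite_rat_order[OF assms False] finite_subset by blast
qed simp

text \<open>At a root of the reduced denominator, regularity would force the numerator to vanish
  too. So the denominator has no root and is constant.\<close>

lemma rat_regular_imp_poly:
  assumes "r \<in> rat_field" "\<And>y. regular_at r y"
  shows "\<exists>p. r = mero_poly p"
proof -
  obtain p q where pq: "q \<noteq> 0" "r = mero_poly p / mero_poly q" "\<And>y. poly p y \<noteq> 0 \<or> poly q y \<noteq> 0"
    using assms(1) by (elim rat_fieldE) blast
  have "poly q y \<noteq> 0" for y
  proof
    assume q: "poly q y = 0"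
    obtain c where "mero_tendsto r y c" using assms(2) regular_at_iff by blast
    then have "mero_tendsto (r * mero_poly q) y (c * poly q y)"
      by (intro mero_tendsto_mult mero_tendsto_poly)
    moreover have "r * mero_poly q = mero_poly p" using pq by simp
    ultimately have "poly p y = 0" using mero_tendsto_unique mero_tendsto_poly q by fastforce
    with pq(3)[of y] q show False by simp
  qed
  then have "degree q = 0" using alg_closed_imp_poly_has_root[of q] by blast
  then obtain c where c: "q = [:c:]" by (rule degree_eq_zeroE)
  then have "r = mero_poly (smult (inverse c) p)"
    using pq(1,2) by (simp add: mero_poly_smult mero_poly_const mero_const_inverse divide_inverse)
  then show ?thesis by blast
qed

lemma rat_order_0_imp_const:
  assumes "r \<in> rat_field" "\<And>y. has_order r y 0"
  shows "r \<in> const_field"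
proof -
  obtain p where p: "r = mero_poly p"
    using rat_regular_imp_poly[OF assms(1)] has_order_imp_ge[OF assms(2)] by blast
  have "poly p y \<noteq> 0" for y
    using assms(2)[of y] mero_tendsto_unique[OF mero_tendsto_poly[of p y]]
    by (auto simp: has_order_def p)
  then have "degree p = 0" using alg_closed_imp_poly_has_root[of p] by blast
  then obtain c where "p = [:c:]" by (rule degree_eq_zeroE)
  then show ?thesis by (simp add: p const_field_def mero_poly_const)
qed

lemma rat_eq_0I:
  assumes "r \<in> rat_field" "infinite {y. mero_tendsto r y 0}"
  shows "r = 0"
proof (rule ccontr)
  assume "r \<noteq> 0"
  have "{y. mero_tendsto r y 0} \<subseteq> {y. \<not> has_order r y 0}"
    using mero_tendsto_unique by (auto simp: has_order_def)
  then show False using finite_rat_order[OF assms(1) \<open>r \<noteq> 0\<close>] assms(2) finite_subset by blast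
qed

section \<open>First-order difference equations over the rational functions\<close>

text \<open>E is constant on the positive and on the nonpositive integers, and each of these
  infinite rays meets the cofinite set where E takes the value c.\<close>

lemma int_two_sided_constant:
  fixes E :: "int \<Rightarrow> 'b"
  assumes fin: "finite {n. E n \<noteq> c}" and step: "\<And>n. n \<noteq> 0 \<Longrightarrow> E (n + 1) = E n"
  shows "E 0 = c" "E 1 = c"
proof -
  have "E (1 + int k) = E 1" for k
    by (induction k) (use step[of "1 + int k" for k] in \<open>auto simp: add_ac\<close>)
  then have "range (\<lambda>k. 1 + int k) \<subseteq> {n. E n \<noteq> c}" if "E 1 \<noteq> c" using that by auto
  moreover have "infinite (range (\<lambda>k. 1 + int k))"
    by (intro range_inj_infinite) (auto simp: inj_on_def)
  ultimately show "E 1 = c" using fin finite_subset by blast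
  have "E (- int k) = E 0" for k
    by (induction k) (use step[of "- 1 - int k" for k] in \<open>auto simp: algebra_simps\<close>)
  then have "range (\<lambda>k. - int k) \<subseteq> {n. E n \<noteq> c}" if "E 0 \<noteq> c" using that by auto
  moreover have "infinite (range (\<lambda>k. - int k))"
    by (intro range_inj_infinite) (auto simp: inj_on_def)
  ultimately show "E 0 = c" using fin finite_subset by blast
qed

lemma finite_int_translates:
  assumes "finite A"
  shows "finite {n::int. (\<alpha>::complex) + of_int n \<in> A}"
  using finite_vimageI[OF assms, of "\<lambda>n. \<alpha> + of_int n"] by (auto simp: inj_on_def vimage_def)

text \<open>Except at n = 0, regularity of f at \<alpha> + n and at \<alpha> + n + 1 is equivalent.
  As f has finitely many poles, it is regular at \<alpha> and at \<alpha> + 1, and the equation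
  gives regularity of g at \<alpha>.\<close>

lemma regular_at_isolated_in_class:
  assumes f: "f \<in> rat_field" "mero_shift f = mero_const l * f + g" and l: "l \<noteq> 0"
    and reg: "\<And>n::int. n \<noteq> 0 \<Longrightarrow> regular_at g (\<alpha> + of_int n)"
  shows "regular_at g \<alpha>"
proof -
  define E where "E = (\<lambda>n::int. regular_at f (\<alpha> + of_int n))"
  have "finite {n. E n \<noteq> True}"
    unfolding E_def using finite_int_translates[OF finite_rat_irregular[OF f(1)], of \<alpha>] by simp
  moreover have "E (n + 1) = E n" if "n \<noteq> 0" for n
  proof -
    have "E (n + 1) \<longleftrightarrow> regular_at (mero_const l * f + g) (\<alpha> + of_int n)"
      unfolding f(2)[symmetric] by (simp add: E_def regular_at_shift add.assoc)
    also have "\<dots> \<longleftrightarrow> regular_at (mero_const l * f) (\<alpha> + of_int n)"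
      using order_ge_diff[of "mero_const l * f + g" _ _ g] order_ge_add reg[OF that]
      by (metis add_diff_cancel_right')
    also have "\<dots> \<longleftrightarrow> E n"
    proof
      assume "regular_at (mero_const l * f) (\<alpha> + of_int n)"
      then have "regular_at (mero_const (inverse l) * (mero_const l * f)) (\<alpha> + of_int n)"
        by (rule order_ge_const_mult)
      moreover have "mero_const (inverse l) * (mero_const l * f) = f"
        using l by (simp add: mero_const_inverse)
      ultimately show "E n" by (simp add: E_def)
    qed (simp add: E_def order_ge_const_mult)
    finally show ?thesis .
  qed
  ultimately have "E 0" "E 1" using int_two_sided_constant[of E True] by auto
  then have "regular_at f \<alpha>" "regular_at (mero_shift f) \<alpha>" by (auto simp: E_def regular_at_shift)
  then have "regular_at (mero_shift f - mero_const l * f) \<alpha>"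
    by (intro order_ge_diff order_ge_const_mult)
  then show ?thesis using f(2) by simp
qed

section \<open>Obstructions for a nonconstant multiplier in standard form\<close>

lemma standard_form_class:
  assumes "standard_form a" "has_order a \<alpha> m" "m \<noteq> 0" "a \<noteq> 0" "n \<noteq> (0::int)"
  shows "has_order a (\<alpha> + of_int n) 0"
proof -
  obtain k where k: "has_order a (\<alpha> + of_int n) k" using ex_has_order[OF assms(4)] by blast
  have "k = 0"
  proof (rule ccontr)
    assume "k \<noteq> 0"
    with has_order_imp_zero_or_pole[OF k] has_order_imp_zero_or_pole[OF assms(2,3)] assms(1,5)
    show False unfolding standard_form_def by (metis add_cancel_left_right of_int_eq_0_iff)
  qed
  with k show ?thesis by simp
qed

lemma nonconst_rat_order:
  assumes "a \<in> rat_field" "a \<noteq> 0" "a \<notin> const_field"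
  obtains \<alpha> m where "has_order a \<alpha> m" "m \<noteq> 0"
  using rat_order_0_imp_const[OF assms(1)] assms(3) ex_has_order[OF assms(2)] by metis

lemma has_order_power: "has_order f y n \<Longrightarrow> has_order (f ^ e) y (int e * n)"
proof (induction e)
  case 0
  show ?case using mero_tendsto_const[of 1 y] by (auto simp: has_order_def intro!: exI[of _ 1])
next
  case (Suc e)
  then have "has_order (f * f ^ e) y (n + int e * n)" by (intro has_order_mult)
  then show ?case by (simp add: distrib_right)
qed

text \<open>Let a have order m \<noteq> 0 at \<alpha>. Along \<alpha> + \<int> the order of y
  changes only between \<alpha> and \<alpha> + 1, by e m; but it is 0 at almost all points, so the
  jump would be 0.\<close>

lemma rat_no_semi_invariant:
  assumes a: "a \<in> rat_field" "a \<noteq> 0" "a \<notin> const_field" "standard_form a"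
    and y: "y \<in> rat_field" "y \<noteq> 0" and e: "e > 0"
  shows "mero_shift y \<noteq> a ^ e * y"
proof
  assume eq: "mero_shift y = a ^ e * y"
  obtain \<alpha> m where m: "has_order a \<alpha> m" "m \<noteq> 0" using nonconst_rat_order[OF a(1-3)] .
  have "\<forall>n::int. \<exists>k. has_order y (\<alpha> + of_int n) k" using ex_has_order[OF y(2)] by blast
  then obtain E where E: "has_order y (\<alpha> + of_int n) (E n)" for n :: int
    by (auto dest!: choice)
  have step: "E (n + 1) = int e * k + E n" if "has_order a (\<alpha> + of_int n) k" for n k
  proof -
    have "has_order (mero_shift y) (\<alpha> + of_int n) (E (n + 1))"
      using E[of "n + 1"] by (simp add: has_order_shift add.assoc)
    moreover have "has_order (mero_shift y) (\<alpha> + of_int n) (int e * k + E n)"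
      unfolding eq by (intro has_order_mult has_order_power that E)
    ultimately show ?thesis by (rule has_order_unique)
  qed
  have "{n. E n \<noteq> 0} \<subseteq> {n. \<alpha> + of_int n \<in> {z. \<not> has_order y z 0}}"
    using E has_order_unique by fastforce
  then have "finite {n. E n \<noteq> 0}"
    using finite_int_translates[OF finite_rat_order[OF y], of \<alpha>] finite_subset by blast
  moreover have "E (n + 1) = E n" if "n \<noteq> 0" for n
    using step[OF standard_form_class[OF a(4) m a(2) that]] by simp
  ultimately have "E 0 = 0" "E 1 = 0" using int_two_sided_constant[of E 0] by blast+
  then show False using step[of 0 m] m e by simp
qed

text \<open>At a pole each differentiation lowers the order by one, so the highest derivative has
  strictly the lowest order and cannot be cancelled by the others.\<close>

lemma not_regular_diff_op:
  assumes "has_order b \<alpha> m" "m < 0"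
  shows "\<not> regular_at ((mero_deriv ^^ n) b - (\<Sum>i<n. mero_const (c i) * (mero_deriv ^^ i) b)) \<alpha>"
proof -
  have "order_ge (\<Sum>i<n. mero_const (c i) * (mero_deriv ^^ i) b) \<alpha> (m - int n + 1)"
  proof (intro order_ge_sum order_ge_const_mult)
    fix i assume "i \<in> {..<n}"
    then show "order_ge ((mero_deriv ^^ i) b) \<alpha> (m - int n + 1)"
      by (intro order_ge_mono[OF has_order_imp_ge[OF has_order_deriv_iter[OF assms]]]) simp
  qed
  from has_order_diff[OF has_order_deriv_iter[OF assms, of n] this] show ?thesis
    using assms(2) by (subst regular_at_iff_order) auto
qed

lemma regular_diff_op:
  "regular_at b \<alpha> \<Longrightarrow>
     regular_at ((mero_deriv ^^ n) b - (\<Sum>i<n. mero_const (c i) * (mero_deriv ^^ i) b)) \<alpha>"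
  by (intro order_ge_diff order_ge_sum order_ge_const_mult regular_at_deriv_iter)

text \<open>The logarithmic derivative of a has a pole at a zero or pole \<alpha> of a and, by
  standard form, at no other point of \<alpha> + \<int>. The operator preserves this, which yields
  an isolated pole in the class.\<close>

lemma rat_no_telescoper:
  assumes a: "a \<in> rat_field" "a \<noteq> 0" "a \<notin> const_field" "standard_form a" and f: "f \<in> rat_field"
  shows "mero_shift f \<noteq> f + ((mero_deriv ^^ n) (mero_deriv a / a) -
           (\<Sum>i<n. mero_const (c i) * (mero_deriv ^^ i) (mero_deriv a / a)))"
    (is "_ \<noteq> f + ?g")
proof
  assume eq: "mero_shift f = f + ?g"
  define \<delta> where "\<delta> = mero_deriv a / a"
  obtain \<alpha> m where m: "has_order a \<alpha> m" "m \<noteq> 0" using nonconst_rat_order[OF a(1-3)] .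
  have da: "mero_deriv a = \<delta> * a" using a(2) by (simp add: \<delta>_def)
  have "has_order (\<delta> * a) \<alpha> (m - 1)" using has_order_deriv[OF m] da by simp
  then have "\<delta> \<noteq> 0" by auto
  then obtain k where k: "has_order \<delta> \<alpha> k" using ex_has_order by blast
  \<comment> \<open>Orders add in \<delta> a = a', and a' has order m - 1; hence the pole of
    \<delta> is simple.\<close>
  have "k + m = m - 1" using has_order_mult[OF k m(1)] \<open>has_order (\<delta> * a) \<alpha> (m - 1)\<close>
    by (rule has_order_unique)
  then have "\<not> regular_at ?g \<alpha>"
    using not_regular_diff_op[OF k, of n c] by (simp add: \<delta>_def)
  moreover have "regular_at ?g (\<alpha> + of_int j)" if "j \<noteq> 0" for j :: int
  proof -
    have "has_order a (\<alpha> + of_int j) 0" by (rule standard_form_class[OF a(4) m a(2) that])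
    moreover from this have "regular_at (mero_deriv a) (\<alpha> + of_int j)"
      by (intro regular_at_deriv has_order_imp_ge)
    ultimately have "regular_at (mero_deriv a / a) (\<alpha> + of_int j)"
      using mero_tendsto_divide by (fastforce simp: has_order_def regular_at_iff)
    then show ?thesis by (rule regular_diff_op)
  qed
  ultimately show False
    using regular_at_isolated_in_class[of f 1 ?g \<alpha>] f eq by simp
qed

text \<open>The operator Q(x + 1) - l Q(x) preserves degrees for l \<noteq> 1 and lowers positive
  degrees by one for l = 1. A monomial of degree d or d + 1, respectively, thus cancels the top
  coefficient of P in degree d.\<close>

lemma poly_first_order_solution:
  fixes P :: "complex poly"
  assumes "l \<noteq> 0"
  shows "\<exists>Q. P = pcompose Q [:1, 1:] - smult l Q"
proof -
  have "\<exists>Q. P = pcompose Q [:1, 1:] - smult l Q" if "\<And>i. i \<ge> d \<Longrightarrow> coeff P i = 0" for d P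
    using that
  proof (induction d arbitrary: P)
    case 0
    then have "P = 0" by (intro poly_eqI) simp
    then show ?case by (intro exI[of _ 0]) simp
  next
    case (Suc d)
    define T where "T = (\<lambda>Q :: complex poly. pcompose Q [:1, 1:] - smult l Q)"
    have ex: "\<exists>Q. degree Q \<le> Suc d \<and> coeff (T Q) (Suc d) = 0 \<and> coeff (T Q) d = coeff P d"
    proof (cases "l = 1")
      case True
      define Q where "Q = monom (coeff P d / of_nat (Suc d)) (Suc d)"
      have "degree Q \<le> Suc d" by (simp add: Q_def degree_monom_le)
      moreover from coeff_pcompose_affine[OF this, of 1 1]
      have "coeff (T Q) (Suc d) = 0" "coeff (T Q) d = coeff P d"
        using True by (simp_all add: T_def Q_def del: of_nat_Suc)
      ultimately show ?thesis by blast
    next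
      case False
      define Q where "Q = monom (coeff P d / (1 - l)) d"
      have "degree Q \<le> Suc d" by (simp add: Q_def le_SucI degree_monom_le)
      moreover from coeff_pcompose_affine[OF this, of 1 1]
      have "coeff (T Q) (Suc d) = 0" "coeff (T Q) d = coeff P d"
        using False by (simp_all add: T_def Q_def diff_divide_distrib[symmetric] field_simps)
      ultimately show ?thesis by blast
    qed
    then obtain Q where Q: "degree Q \<le> Suc d" "coeff (T Q) (Suc d) = 0" "coeff (T Q) d = coeff P d"
      by blast
    have deg: "degree (T Q) \<le> Suc d"
      unfolding T_def using Q(1) degree_pcompose_le[of Q "[:1, 1:]"]
      by (intro degree_diff_le) (auto intro: order_trans)
    have "coeff (P - T Q) i = 0" if i: "i \<ge> d" for i
    proof -
      consider "i = d" | "i = Suc d" | "i > Suc d" using i by linarith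
      then show ?thesis
        using Q Suc.prems deg by cases (auto simp: coeff_eq_0)
    qed
    then obtain R where "P - T Q = T R" using Suc.IH unfolding T_def by blast
    then have "P = T (Q + R)" by (simp add: T_def pcompose_add smult_add_right algebra_simps)
    then show ?case unfolding T_def by blast
  qed
  from this[of "Suc (degree P)" P] show ?thesis by (auto simp: coeff_eq_0)
qed

section \<open>Partial fractions and reduction modulo \<sigma>(g) - l g\<close>

inductive_set partial_fractions :: "mero set" where
  poly: "mero_poly p \<in> partial_fractions"
| lin: "mero_const c * mero_lin y (- int j) \<in> partial_fractions"
| add: "f \<in> partial_fractions \<Longrightarrow> g \<in> partial_fractions \<Longrightarrow> f + g \<in> partial_fractions"

lemma partial_fractions_const_mult:
  "f \<in> partial_fractions \<Longrightarrow> mero_const d * f \<in> partial_fractions"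
proof (induction rule: partial_fractions.induct)
  case (poly p)
  then show ?case using partial_fractions.poly[of "smult d p"] by (simp add: mero_poly_smult)
next
  case (lin c y j)
  then show ?case using partial_fractions.lin[of "d * c" y j] by (simp add: mero_const_mult mult.assoc)
next
  case (add f g)
  then show ?case by (simp add: distrib_left partial_fractions.add)
qed

lemma mero_lin_partial: "mero_lin y (- int j) \<in> partial_fractions"
  using partial_fractions.lin[of 1 y j] by simp

lemma mero_lin_neg_Suc: "mero_lin y (- int (Suc j)) = mero_lin y (- int j) * mero_lin y (- 1)"
  using mero_lin_add[of y "- int j" "- 1"] by (simp add: algebra_simps)

text \<open>For y \<noteq> z the identity 1/((x - y)(x - z)) = (1/(x - y) - 1/(x - z))/(y - z)
  lowers the exponent of x - y, and induction on it applies.\<close>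

lemma mero_lin_mult_partial: "mero_lin y (- int j) * mero_lin z (- 1) \<in> partial_fractions"
proof (cases "y = z")
  case True
  have "mero_lin y (- int j) * mero_lin z (- 1) = mero_lin z (- int (Suc j))"
    unfolding True by (simp only: mero_lin_neg_Suc)
  then show ?thesis using mero_lin_partial[of z "Suc j"] by simp
next
  case False
  define k where "k = mero_const (inverse (y - z))"
  have "mero_lin y 1 * mero_lin y (- 1) = 1" "mero_lin z 1 * mero_lin z (- 1) = 1"
    by (rule mero_lin_cancel)+
  moreover have "mero_lin z 1 - mero_lin y 1 = mero_const (y - z)"
    by (simp add: mero_lin_1 mero_const_diff)
  ultimately have "mero_const (y - z) * (mero_lin y (- 1) * mero_lin z (- 1)) =
      mero_lin y (- 1) - mero_lin z (- 1)"
    by (smt (verit) left_diff_distrib mult.assoc mult.commute mult.left_neutral)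
  moreover have "k * mero_const (y - z) = 1"
    using False by (simp add: k_def flip: mero_const_mult)
  ultimately have split: "mero_lin y (- 1) * mero_lin z (- 1) = k * (mero_lin y (- 1) - mero_lin z (- 1))"
    by (metis mult.assoc mult.left_neutral)
  show ?thesis
  proof (induction j)
    case 0
    show ?case using mero_lin_partial[of z 1] by simp
  next
    case (Suc j)
    have "mero_lin y (- int (Suc j)) * mero_lin z (- 1) =
        mero_lin y (- int j) * (mero_lin y (- 1) * mero_lin z (- 1))"
      by (simp only: mero_lin_neg_Suc mult.assoc)
    also have "\<dots> = k * (mero_lin y (- int j) * mero_lin y (- 1) +
        mero_const (- 1) * (mero_lin y (- int j) * mero_lin z (- 1)))"
      unfolding split mero_const_diff[of 0 1, simplified] by (simp add: algebra_simps)
    also have "mero_lin y (- int j) * mero_lin y (- 1) = mero_lin y (- int (Suc j))"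
      by (simp only: mero_lin_neg_Suc)
    finally show ?case
      unfolding k_def using Suc mero_lin_partial[of y "Suc j"]
      by (auto intro!: partial_fractions_const_mult partial_fractions.add)
  qed
qed

lemma partial_fractions_mult_lin:
  "f \<in> partial_fractions \<Longrightarrow> f * mero_lin z (- 1) \<in> partial_fractions"
proof (induction rule: partial_fractions.induct)
  case (poly p)
  have "mero_poly p * mero_lin z (- 1) =
      mero_poly ([:- z, 1:] * synthetic_div p z + [:poly p z:]) * mero_lin z (- 1)"
    by (simp only: synthetic_div_correct')
  also have "\<dots> = mero_poly (synthetic_div p z) * (mero_lin z 1 * mero_lin z (- 1)) +
      mero_const (poly p z) * mero_lin z (- 1)"
    by (simp only: mero_poly_add mero_poly_mult mero_poly_linear mero_poly_const) (simp add: algebra_simps)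
  also have "\<dots> = mero_poly (synthetic_div p z) + mero_const (poly p z) * mero_lin z (- 1)"
    by (simp only: mero_lin_cancel mult_1_right)
  finally show ?case
    using partial_fractions.lin[of "poly p z" z 1] by (auto intro: partial_fractions.add partial_fractions.poly)
next
  case (lin c y j)
  then show ?case using partial_fractions_const_mult[OF mero_lin_mult_partial[of y j z], of c]
    by (simp add: mult.assoc)
next
  case (add f g)
  then show ?case by (simp add: distrib_right partial_fractions.add)
qed

lemma rat_field_partial_fractions: "rat_field \<subseteq> partial_fractions"
proof
  fix r assume "r \<in> rat_field"
  then obtain p q where "q \<noteq> 0" "r = mero_poly p / mero_poly q" by (elim rat_fieldE)
  moreover have "f / mero_poly q \<in> partial_fractions"
    if "q \<noteq> 0" "degree q = d" "f \<in> partial_fractions" for q d f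
    using that
  proof (induction d arbitrary: q f)
    case 0
    then obtain c where "q = [:c:]" by (auto elim: degree_eq_zeroE)
    then show ?case using partial_fractions_const_mult[OF 0(3), of "inverse c"]
      by (simp add: mero_poly_const mero_const_inverse divide_inverse mult.commute)
  next
    case (Suc d)
    then obtain z where "poly q z = 0" using alg_closed_imp_poly_has_root[of q] by auto
    then obtain q1 where q1: "q = [:- z, 1:] * q1" by (auto simp: poly_eq_0_iff_dvd elim: dvdE)
    have "q1 \<noteq> 0" using Suc.prems(1) q1 by auto
    then have "degree q = Suc (degree q1)" unfolding q1 by (subst degree_mult_eq) auto
    then have "f * mero_lin z (- 1) / mero_poly q1 \<in> partial_fractions"
      using Suc \<open>q1 \<noteq> 0\<close> by (auto intro: partial_fractions_mult_lin)
    moreover have "mero_lin z (- 1) = inverse (mero_lin z 1)"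
      using mero_lin_cancel(1)[of z 1] by (metis inverse_unique)
    moreover have "mero_poly q = mero_lin z 1 * mero_poly q1"
      by (simp only: q1 mero_poly_mult mero_poly_linear)
    ultimately show ?case by (simp add: divide_inverse mult_ac)
  qed
  ultimately show "r \<in> partial_fractions" using partial_fractions.poly by blast
qed

text \<open>Modulo functions \<sigma>(g) - l g, a pole term may be translated by any integer, up to
  a power of l as factor. So every pole can be moved to the point of its class with real part in [0,
  1).\<close>

lemma reduce_to_strip:
  assumes l: "l \<noteq> 0" and b: "b \<in> rat_field"
  obtains g s where "g \<in> rat_field" "s \<in> rat_field" "b = mero_shift g - mero_const l * g + s"
    "\<And>y. Re y < 0 \<or> Re y \<ge> 1 \<Longrightarrow> regular_at s y"
proof -
  note R = is_subfield_rat_field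
  define strip where "strip = (\<lambda>s. \<forall>y. Re y < 0 \<or> Re y \<ge> 1 \<longrightarrow> regular_at s y)"
  define U where "U = {f. \<exists>g s. g \<in> rat_field \<and> s \<in> rat_field \<and> strip s \<and>
    f = mero_shift g - mero_const l * g + s}"
  have UI: "f \<in> U" if "f = mero_shift g - mero_const l * g + s" "g \<in> rat_field" "s \<in> rat_field" "strip s"
    for f g s
    unfolding U_def using that by blast
  have UE: "\<exists>g s. g \<in> rat_field \<and> s \<in> rat_field \<and> strip s \<and> f = mero_shift g - mero_const l * g + s"
    if "f \<in> U" for f
    using that unfolding U_def by blast
  have U_strip: "s \<in> U" if "s \<in> rat_field" "strip s" for s
    by (rule UI[of _ 0 s]) (use that is_subfield_0[OF R] in auto)
  have U_exact: "mero_shift g - mero_const l * g \<in> U" if "g \<in> rat_field" for g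
    by (rule UI[of _ g 0]) (use that is_subfield_0[OF R] in \<open>auto simp: strip_def\<close>)
  have U_add: "f + f' \<in> U" if f: "f \<in> U" and f': "f' \<in> U" for f f'
  proof -
    obtain g s where 1: "g \<in> rat_field" "s \<in> rat_field" "strip s"
      "f = mero_shift g - mero_const l * g + s" using UE[OF f] by blast
    obtain g' s' where 2: "g' \<in> rat_field" "s' \<in> rat_field" "strip s'"
      "f' = mero_shift g' - mero_const l * g' + s'" using UE[OF f'] by blast
    show ?thesis
    proof (rule UI)
      show "f + f' = mero_shift (g + g') - mero_const l * (g + g') + (s + s')"
        unfolding 1(4) 2(4) by (simp add: mero.hom_add algebra_simps)
      show "strip (s + s')" using 1(3) 2(3) by (auto simp: strip_def intro: order_ge_add)
    qed (use 1 2 is_subfield_add[OF R] in auto)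
  qed
  have U_const: "mero_const c * f \<in> U" if f: "f \<in> U" for c f
  proof -
    obtain g s where 1: "g \<in> rat_field" "s \<in> rat_field" "strip s"
      "f = mero_shift g - mero_const l * g + s" using UE[OF f] by blast
    show ?thesis
    proof (rule UI)
      show "mero_const c * f =
          mero_shift (mero_const c * g) - mero_const l * (mero_const c * g) + mero_const c * s"
        unfolding 1(4) by (simp add: mero.hom_mult algebra_simps)
      show "strip (mero_const c * s)" using 1(3) by (auto simp: strip_def intro: order_ge_const_mult)
    qed (use 1 is_subfield_mult[OF R mero_const_in_rat_field] in auto)
  qed
  have U_lin: "mero_lin (\<alpha> + of_int k) (- int j) \<in> U" if \<alpha>: "0 \<le> Re \<alpha>" "Re \<alpha> < 1" for \<alpha> j k
  proof (induction k rule: int_induct[where k = 0])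
    case base
    have "regular_at (mero_lin \<alpha> (- int j)) y" if "Re y < 0 \<or> Re y \<ge> 1" for y
      using mero_tendsto_lin[of y \<alpha> "- int j"] that \<alpha> unfolding regular_at_iff by fastforce
    then show ?case by (auto intro!: U_strip mero_lin_in_rat_field simp: strip_def)
  next
    case (step1 k)
    define g where "g = mero_lin (\<alpha> + of_int (k + 1)) (- int j)"
    have sg: "mero_shift g = mero_lin (\<alpha> + of_int k) (- int j)"
      by (simp add: g_def mero_lin_shift algebra_simps)
    \<comment> \<open>Solving \<sigma>(g) - l g for g expresses a pole term by its left neighbour;
      the opposite direction solves for \<sigma>(g).\<close>
    have "g = mero_const (inverse l) *
        (mero_const (- 1) * (mero_shift g - mero_const l * g) + mero_shift g)"
      using l by (simp add: mero_const_inverse mero_const_diff[of 0 1, simplified])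
    also have "\<dots> \<in> U"
      using step1(2) by (intro U_const U_add U_exact) (simp_all add: sg, simp add: g_def mero_lin_in_rat_field)
    finally show ?case by (simp add: g_def)
  next
    case (step2 k)
    define g where "g = mero_lin (\<alpha> + of_int k) (- int j)"
    have sg: "mero_shift g = mero_lin (\<alpha> + of_int (k - 1)) (- int j)"
      by (simp add: g_def mero_lin_shift algebra_simps)
    have "mero_shift g = (mero_shift g - mero_const l * g) + mero_const l * g" by simp
    also have "\<dots> \<in> U"
      using step2(2) by (intro U_const U_add U_exact) (simp_all add: g_def mero_lin_in_rat_field)
    finally show ?case by (simp add: sg)
  qed
  have "f \<in> U" if "f \<in> partial_fractions" for f
    using that
  proof (induction rule: partial_fractions.induct)
    case (poly p)
    then show ?case
      by (intro U_strip mero_poly_in_rat_field) (use mero_tendsto_poly in \<open>auto simp: strip_def regular_at_iff\<close>)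
  next
    case (lin c y j)
    define k where "k = \<lfloor>Re y\<rfloor>"
    have "0 \<le> Re (y - of_int k)" "Re (y - of_int k) < 1" unfolding k_def by (simp_all, linarith+)
    from U_const[OF U_lin[OF this, of k j], of c] show ?case by simp
  next
    case (add f g)
    then show ?case by (intro U_add)
  qed
  then have "b \<in> U" using b rat_field_partial_fractions by blast
  from UE[OF this] show ?thesis using that unfolding strip_def by blast
qed

text \<open>L commutes with \<sigma> and with constant factors, so f - L(g) solves the equation for
  the reduced part s. A pole of s would be alone in its class and survive under L, which is
  impossible; hence s is a polynomial, and polynomials have the required form.\<close>

lemma rat_telescoper_imp_exact:
  assumes l: "l \<noteq> 0" and b: "b \<in> rat_field" and f: "f \<in> rat_field"
    and eq: "mero_shift f = mero_const l * f +
      ((mero_deriv ^^ n) b - (\<Sum>i<n. mero_const (c i) * (mero_deriv ^^ i) b))"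
  shows "\<exists>g\<in>rat_field. b = mero_shift g - mero_const l * g"
proof -
  note R = is_subfield_rat_field
  define L where "L = (\<lambda>b. (mero_deriv ^^ n) b - (\<Sum>i<n. mero_const (c i) * (mero_deriv ^^ i) b))"
  have D_add: "(mero_deriv ^^ i) (u + v) = (mero_deriv ^^ i) u + (mero_deriv ^^ i) v" for i u v
    by (induction i) (auto simp: mero_deriv_add)
  have D_const: "(mero_deriv ^^ i) (mero_const d * u) = mero_const d * (mero_deriv ^^ i) u" for i d u
    by (induction i) (auto simp: mero_deriv_mult)
  have D_shift: "(mero_deriv ^^ i) (mero_shift u) = mero_shift ((mero_deriv ^^ i) u)" for i u
    by (induction i) (auto simp: mero_deriv_shift)
  have L_add: "L (u + v) = L u + L v" for u v
    by (simp add: L_def D_add distrib_left sum.distrib)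
  have L_const: "L (mero_const d * u) = mero_const d * L u" for d u
    unfolding L_def D_const right_diff_distrib sum_distrib_left by (simp only: mult.left_commute)
  have L_shift: "L (mero_shift u) = mero_shift (L u)" for u
    by (simp add: L_def D_shift mero.hom_simps)
  have L_rat: "L u \<in> rat_field" if "u \<in> rat_field" for u
    unfolding L_def using that
    by (intro is_subfield_minus is_subfield_sum is_subfield_mult R mero_const_in_rat_field
        mero_deriv_iter_rat_field)
  obtain g s where gs: "g \<in> rat_field" "s \<in> rat_field" "b = mero_shift g - mero_const l * g + s"
    "\<And>y. Re y < 0 \<or> Re y \<ge> 1 \<Longrightarrow> regular_at s y"
    using reduce_to_strip[OF l b] by blast
  have "mero_shift g - mero_const l * g = mero_shift g + mero_const (- l) * g"
    using mero_const_diff[of 0 l] by simp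
  then have "L b = mero_shift (L g) + mero_const (- l) * L g + L s"
    unfolding gs(3) by (simp only: L_add L_const L_shift)
  also have "mero_const (- l) = - mero_const l" using mero_const_diff[of 0 l] by simp
  finally have Lb: "L b = mero_shift (L g) + - mero_const l * L g + L s" .
  have eq': "mero_shift f = mero_const l * f + L b" using eq by (simp only: L_def)
  have Ls: "mero_shift (f - L g) = mero_const l * (f - L g) + L s"
    using eq' by (simp add: mero.hom_diff Lb algebra_simps)
  have "regular_at s \<alpha>" for \<alpha>
  proof (rule ccontr)
    assume irr: "\<not> regular_at s \<alpha>"
    then have \<alpha>: "0 \<le> Re \<alpha>" "Re \<alpha> < 1" using gs(4)[of \<alpha>] by linarith+
    have "s \<noteq> 0" using irr by auto
    then obtain m where m: "has_order s \<alpha> m" using ex_has_order by blast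
    have "m < 0" using irr regular_at_iff_order[OF m] by simp
    \<comment> \<open>A nonzero integer translate of a point of the half-open strip lies outside it,
      where s is regular.\<close>
    have "regular_at (L s) (\<alpha> + of_int j)" if "j \<noteq> 0" for j :: int
    proof -
      have "j \<le> -1 \<or> j \<ge> 1" using that by linarith
      then have "real_of_int j \<le> -1 \<or> real_of_int j \<ge> 1" by linarith
      then have "Re (\<alpha> + of_int j) < 0 \<or> Re (\<alpha> + of_int j) \<ge> 1" using \<alpha> by auto
      then show ?thesis unfolding L_def by (intro regular_diff_op gs(4))
    qed
    then have "regular_at (L s) \<alpha>"
      using regular_at_isolated_in_class[OF is_subfield_minus[OF R f L_rat[OF gs(1)]] Ls l] by blast
    then show False using not_regular_diff_op[OF m \<open>m < 0\<close>] by (simp add: L_def)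
  qed
  then obtain p where p: "s = mero_poly p" using rat_regular_imp_poly[OF gs(2)] by blast
  obtain q where "p = pcompose q [:1, 1:] - smult l q" using poly_first_order_solution[OF l] by blast
  then have "s = mero_shift (mero_poly q) - mero_const l * mero_poly q"
    by (simp only: p mero_poly_diff mero_poly_smult mero_shift_poly)
  then have "b = mero_shift (g + mero_poly q) - mero_const l * (g + mero_poly q)"
    unfolding gs(3) by (simp add: mero.hom_add algebra_simps)
  then show ?thesis using gs(1) mero_poly_in_rat_field is_subfield_add[OF R] by blast
qed

section \<open>Descent from periodic to constant coefficients\<close>

lemma is_subfield_periodic_field: "is_subfield periodic_field"
  by (auto simp: is_subfield_def periodic_field_def mero.hom_simps)

lemma is_subfield_base_field: "is_subfield base_field"
  unfolding base_field_def by (rule is_subfield_adjoin[OF is_subfield_periodic_field])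

lemma periodic_subset_base_field: "periodic_field \<subseteq> base_field"
  unfolding base_field_def by (rule subset_adjoin[OF is_subfield_periodic_field])

lemma mero_x_in_base_field: "mero_x \<in> base_field"
  unfolding base_field_def by (rule gen_in_adjoin[OF is_subfield_periodic_field])

lemma rat_subset_base_field: "rat_field \<subseteq> base_field"
  unfolding rat_field_def
proof (rule adjoin_least[OF is_subfield_const_field is_subfield_base_field])
  show "const_field \<subseteq> base_field"
    using periodic_subset_base_field by (auto simp: const_field_def periodic_field_def)
qed (rule mero_x_in_base_field)

lemma mero_shift_base_field:
  assumes "f \<in> base_field"
  shows "mero_shift f \<in> base_field"
proof (rule mero.hom_adjoin[OF is_subfield_periodic_field is_subfield_base_field, where t = mero_x])
  show "mero_shift g \<in> base_field" if "g \<in> periodic_field" for g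
    using that periodic_subset_base_field by (auto simp: periodic_field_def)
  show "mero_shift mero_x \<in> base_field"
    by (simp add: mero_shift_x is_subfield_add is_subfield_1 is_subfield_base_field mero_x_in_base_field)
qed (use assms in \<open>simp add: base_field_def\<close>)

lemma mero_deriv_base_field:
  assumes "f \<in> base_field"
  shows "mero_deriv f \<in> base_field"
proof (rule mero.D_adjoin[OF is_subfield_periodic_field is_subfield_base_field, where t = mero_x])
  show "g \<in> base_field \<and> mero_deriv g \<in> base_field" if "g \<in> periodic_field" for g
  proof -
    have "mero_deriv g \<in> periodic_field"
      using that by (simp add: periodic_field_def flip: mero_deriv_shift)
    with that periodic_subset_base_field show ?thesis by blast
  qed
qed (use assms is_subfield_1[OF is_subfield_base_field] in
      \<open>auto simp: base_field_def[symmetric] mero_deriv_x mero_x_in_base_field\<close>)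

text \<open>Each F in S is exceptional at countably many points only, and countably many translates
  of such sets do not cover the uncountable plane.\<close>

lemma generic_point:
  assumes "countable S"
  obtains y where "\<And>F n::nat. F \<in> S \<Longrightarrow> \<exists>c. mero_tendsto F (y + of_nat n) c \<and> (F \<noteq> 0 \<longrightarrow> c \<noteq> 0)"
proof -
  define B where "B = (\<lambda>F. {y. \<not> (\<exists>c. mero_tendsto F y c \<and> (F \<noteq> 0 \<longrightarrow> c \<noteq> 0))})"
  have "countable (B F)" for F
  proof (cases "F = 0")
    case True
    then have "B F = {y. \<not> (\<exists>c. mero_tendsto F y c)}" by (simp add: B_def)
    then show ?thesis using countable_mero_no_limit by simp
  next
    case False
    then have "B F = {y. \<not> (\<exists>c. c \<noteq> 0 \<and> mero_tendsto F y c)}" by (auto simp: B_def)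
    then show ?thesis using countable_mero_no_nonzero_limit[OF False] by simp
  qed
  then have "countable (\<Union>F\<in>S. \<Union>n::nat. (\<lambda>z. z - of_nat n) ` B F)"
    using assms by (intro countable_UN countable_image) auto
  then have "(\<Union>F\<in>S. \<Union>n::nat. (\<lambda>z. z - of_nat n) ` B F) \<noteq> UNIV"
    using uncountable_UNIV_complex by metis
  then obtain y where y: "\<And>F n::nat. F \<in> S \<Longrightarrow> y \<notin> (\<lambda>z. z - of_nat n) ` B F" by blast
  have "\<exists>c. mero_tendsto F (y + of_nat n) c \<and> (F \<noteq> 0 \<longrightarrow> c \<noteq> 0)" if "F \<in> S" for F and n :: nat
  proof (rule ccontr)
    assume "\<not> ?thesis"
    then have "y + of_nat n \<in> B F" by (simp add: B_def)
    then have "y \<in> (\<lambda>z. z - of_nat n) ` B F" by (intro image_eqI[of _ _ "y + of_nat n"]) auto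
    with y[OF that] show False by blast
  qed
  then show ?thesis using that by blast
qed

lemma mero_tendsto_poly_coeffs:
  assumes "\<And>i. mero_tendsto (coeff P i) y (coeff p i)"
  shows "mero_tendsto (poly P mero_x) y (poly p y)"
  using assms
proof (induction P arbitrary: p)
  case 0
  then have "p = 0" using mero_tendsto_unique[OF mero_tendsto_0, of y] by (intro poly_eqI) fastforce
  then show ?case by simp
next
  case (pCons A P)
  obtain a p' where p: "p = pCons a p'" by (cases p)
  have "mero_tendsto A y a" "mero_tendsto (poly P mero_x) y (poly p' y)"
    using pCons.prems[of 0] pCons.prems[of "Suc i" for i] pCons.IH[of p'] by (simp_all add: p)
  then show ?case by (simp add: p mero_tendsto_add mero_tendsto_mult mero_tendsto_x)
qed

text \<open>
  Periodic coefficients are constant along \<open>y + \<nat>\<close>, so restricting an identity over \<open>k\<^sub>0(x)\<close> to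
  this progression gives an identity between rational functions with constant coefficients.
\<close>

lemma descent:
  fixes n :: nat
  assumes f: "f \<in> base_field" and \<mu>: "\<mu> \<in> rat_field" and g: "\<And>i. g i \<in> rat_field"
    and C: "\<And>i. i < n \<Longrightarrow> mero_shift (C i) = C i"
    and eq: "mero_shift f = \<mu> * f + (g n - (\<Sum>i<n. C i * g i))"
  obtains f' c where "f' \<in> rat_field" "f \<noteq> 0 \<Longrightarrow> f' \<noteq> 0"
    "mero_shift f' = \<mu> * f' + (g n - (\<Sum>i<n. mero_const (c i) * g i))"
proof -
  note R = is_subfield_rat_field
  obtain P Q where PQ: "P \<in> polys_over periodic_field" "Q \<in> polys_over periodic_field"
    "poly Q mero_x \<noteq> 0" "f = poly P mero_x / poly Q mero_x"
    using f unfolding base_field_def by (elim adjoinE[OF is_subfield_periodic_field])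
  \<comment> \<open>All functions whose limits along the progression are taken. Having
    \<open>poly Q mero_x\<close> and \<open>f\<close> among them keeps the new denominator nonzero
    there and makes f' nonzero whenever f is.\<close>
  define S where "S = range (coeff P) \<union> range (coeff Q) \<union> range C \<union> range g \<union> {\<mu>, f, poly Q mero_x}"
  have "countable S" unfolding S_def by (intro countable_Un countable_image) auto
  then obtain y where y: "\<And>F n::nat. F \<in> S \<Longrightarrow>
      \<exists>c. mero_tendsto F (y + of_nat n) c \<and> (F \<noteq> 0 \<longrightarrow> c \<noteq> 0)"
    using generic_point by blast
  define ev where "ev = (\<lambda>F n. THE c. mero_tendsto F (y + of_nat n) c)"
  have ev: "mero_tendsto F (y + of_nat n) (ev F n)" "F \<noteq> 0 \<Longrightarrow> ev F n \<noteq> 0" if F: "F \<in> S" for F n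
  proof -
    obtain c where c: "mero_tendsto F (y + of_nat n) c" "F \<noteq> 0 \<longrightarrow> c \<noteq> 0" using y[OF F] by blast
    then have "ev F n = c" unfolding ev_def using mero_tendsto_unique by blast
    with c show "mero_tendsto F (y + of_nat n) (ev F n)" "F \<noteq> 0 \<Longrightarrow> ev F n \<noteq> 0" by auto
  qed
  have ev_periodic: "mero_tendsto F (y + of_nat n) (ev F 0)" if "F \<in> S" "mero_shift F = F" for F n
  proof (induction n)
    case (Suc n)
    then show ?case using mero_tendsto_shift[of F "y + of_nat n"] that(2) by (simp add: add_ac)
  qed (use ev(1)[OF that(1), of 0] in simp)
  have ev0: "ev 0 0 = 0"
    unfolding ev_def using mero_tendsto_unique[OF mero_tendsto_0] by (intro the_equality) auto
  define p q where "p = map_poly (\<lambda>F. ev F 0) P" and "q = map_poly (\<lambda>F. ev F 0) Q"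
  have evP: "mero_tendsto (poly P mero_x) (y + of_nat m) (poly p (y + of_nat m))" for m
    using PQ(1) by (intro mero_tendsto_poly_coeffs)
      (auto simp: p_def coeff_map_poly ev0 S_def polys_over_def periodic_field_def intro!: ev_periodic)
  have evQ: "mero_tendsto (poly Q mero_x) (y + of_nat m) (poly q (y + of_nat m))" for m
    using PQ(2) by (intro mero_tendsto_poly_coeffs)
      (auto simp: q_def coeff_map_poly ev0 S_def polys_over_def periodic_field_def intro!: ev_periodic)
  have q0: "poly q (y + of_nat m) \<noteq> 0" for m
  proof -
    have "poly Q mero_x \<in> S" by (simp add: S_def)
    from ev(1)[OF this, of m] ev(2)[OF this PQ(3), of m] show ?thesis
      using mero_tendsto_unique[OF evQ[of m]] by simp
  qed
  define f' where "f' = mero_poly p / mero_poly q"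
  have f'R: "f' \<in> rat_field"
    unfolding f'_def by (intro is_subfield_divide R mero_poly_in_rat_field)
  have f'_ev: "mero_tendsto f' (y + of_nat m) (ev f m)" for m
  proof -
    have "mero_tendsto f (y + of_nat m) (poly p (y + of_nat m) / poly q (y + of_nat m))"
      unfolding PQ(4) by (intro mero_tendsto_divide evP evQ q0)
    moreover have "f \<in> S" by (simp add: S_def)
    ultimately have "ev f m = poly p (y + of_nat m) / poly q (y + of_nat m)"
      using mero_tendsto_unique ev(1) by blast
    then show ?thesis unfolding f'_def by (simp add: rat_tendsto q0)
  qed
  define c where "c = (\<lambda>i. ev (C i) 0)"
  define r where "r = mero_shift f' - (\<mu> * f' + (g n - (\<Sum>i<n. mero_const (c i) * g i)))"
  have "r \<in> rat_field"
    unfolding r_def using f'R \<mu> g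
    by (intro is_subfield_minus is_subfield_add is_subfield_mult is_subfield_sum R
        mero_shift_rat_field mero_const_in_rat_field)
  have r0: "mero_tendsto r (y + of_nat m) 0" for m
  proof -
    \<comment> \<open>\<open>E\<close> is the limit both of \<open>r\<close> and of the difference
      of the two sides of \<open>eq\<close>; the latter is identically zero.\<close>
    define E where "E = ev f (Suc m) - (ev \<mu> m * ev f m + (ev (g n) m - (\<Sum>i<n. c i * ev (g i) m)))"
    have S: "f \<in> S" "\<mu> \<in> S" "g i \<in> S" "C i \<in> S" for i by (auto simp: S_def)
    have 1: "mero_tendsto (mero_shift f) (y + of_nat m) (ev f (Suc m))"
      "mero_tendsto (mero_shift f') (y + of_nat m) (ev f (Suc m))"
      using ev(1)[OF S(1), of "Suc m"] f'_ev[of "Suc m"] by (simp_all add: mero_tendsto_shift add_ac)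
    have "mero_tendsto r (y + of_nat m) E"
      unfolding r_def E_def
      by (intro mero_tendsto_diff mero_tendsto_add mero_tendsto_mult mero_tendsto_sum
          mero_tendsto_const 1 f'_ev ev(1) S)
    moreover have "mero_tendsto (mero_shift f - (\<mu> * f + (g n - (\<Sum>i<n. C i * g i)))) (y + of_nat m) E"
      unfolding E_def c_def
      by (intro mero_tendsto_diff mero_tendsto_add mero_tendsto_mult mero_tendsto_sum
          ev_periodic 1 ev(1) S) (use C in auto)
    then have "E = 0" using eq mero_tendsto_unique[OF mero_tendsto_0] by fastforce
    ultimately show ?thesis by simp
  qed
  have "infinite (range (\<lambda>m::nat. y + of_nat m))"
    by (intro range_inj_infinite) (auto simp: inj_on_def)
  moreover have "range (\<lambda>m::nat. y + of_nat m) \<subseteq> {z. mero_tendsto r z 0}" using r0 by auto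
  ultimately have "r = 0" using rat_eq_0I[OF \<open>r \<in> rat_field\<close>] finite_subset by blast
  moreover have "f' \<noteq> 0" if "f \<noteq> 0"
  proof
    assume "f' = 0"
    with f'_ev[of 0] have "ev f 0 = 0" using mero_tendsto_unique[OF mero_tendsto_0] by fastforce
    with ev(2)[of f 0] that show False by (simp add: S_def)
  qed
  ultimately show ?thesis using f'R by (intro that[of f' c]) (auto simp: r_def)
qed

text \<open>The witness is Y' - u Y - v, with \<open>m1\<close>, \<open>m0\<close> and 0 as the
  exponent vectors of Y', Y and the constant monomial.\<close>

lemma differentially_algebraic_first_order:
  fixes u v z :: "'a :: field"
  assumes K: "is_subfield K" and "u \<in> K" "v \<in> K" and z: "D z = u * z + v"
  shows "differentially_algebraic D K z"
proof -
  define m0 m1 :: "nat \<Rightarrow>\<^sub>0 nat" where "m0 = Poly_Mapping.single 0 1" and "m1 = Poly_Mapping.single 1 1"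
  define P :: "'a diff_poly" where
    "P = Poly_Mapping.single m1 1 + Poly_Mapping.single m0 (- u) + Poly_Mapping.single 0 (- v)"
  have ne: "m0 \<noteq> m1" "m0 \<noteq> 0" "m1 \<noteq> 0"
  proof -
    have "Poly_Mapping.lookup m0 0 = 1" "Poly_Mapping.lookup m1 0 = 0" "Poly_Mapping.lookup m1 1 = 1"
      by (simp_all add: m0_def m1_def lookup_single)
    then show "m0 \<noteq> m1" "m0 \<noteq> 0" "m1 \<noteq> 0" by auto
  qed
  have lookup: "Poly_Mapping.lookup P m =
      (if m = m1 then 1 else if m = m0 then - u else if m = 0 then - v else 0)" for m
    using ne by (auto simp: P_def lookup_add lookup_single when_def)
  have "eval_diff_poly D P z = (\<Sum>m\<in>{m1, m0, 0}. Poly_Mapping.lookup P m *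
        (\<Prod>i\<in>Poly_Mapping.keys m. ((D ^^ i) z) ^ Poly_Mapping.lookup m i))"
    unfolding eval_diff_poly_def
    by (intro sum.mono_neutral_left) (auto simp: in_keys_iff lookup split: if_splits)
  also have "\<dots> = D z - u * z - v"
    using ne by (simp add: lookup) (simp add: m0_def m1_def lookup_single)
  finally have "eval_diff_poly D P z = 0" using z by simp
  moreover have "P \<noteq> 0" using lookup[of m1] by auto
  moreover have "Poly_Mapping.lookup P m \<in> K" for m
    unfolding lookup using assms is_subfield_intros[OF K] by auto
  ultimately show ?thesis unfolding differentially_algebraic_def by blast
qed

section \<open>The dichotomy between nonconstant and constant multipliers\<close>

theorem proposition3p9:
  fixes a b z :: mero
  assumes "a \<in> rat_field" and "b \<in> rat_field"
    and "a \<noteq> 0" and "standard_form a"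
    and "mero_shift z = a * z + b"
    and "z \<notin> base_field"
  shows "(a \<notin> const_field \<longrightarrow> \<not> differentially_algebraic mero_deriv base_field z) \<and>
         (a \<in> const_field \<longrightarrow>
            (differentially_algebraic mero_deriv base_field z \<longleftrightarrow>
             (\<exists>f\<in>rat_field. b = mero_shift f - a * f)))"
proof (intro conjI impI)
  note K = is_subfield_base_field
  note R = is_subfield_rat_field
  have fixK: "x \<in> base_field" if "mero_shift x = x" for x
    using that periodic_subset_base_field by (auto simp: periodic_field_def)
  have RK: "x \<in> base_field" if "x \<in> rat_field" for x using that rat_subset_base_field by blast
  {
    assume nonconst: "a \<notin> const_field"
    have semi: "mero_shift y \<noteq> a ^ e * y" if y: "y \<in> base_field" "y \<noteq> 0" "e > 0" for y e
    proof
      assume eq: "mero_shift y = a ^ e * y"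
      \<comment> \<open>The homogeneous equation is brought into the shape of \<open>descent\<close>
        with n = 0 and zero families.\<close>
      have "mero_shift y = a ^ e * y + ((\<lambda>_. 0) 0 - (\<Sum>i<0. (\<lambda>_. 0) i * (\<lambda>_. 0) i))"
        using eq by simp
      from descent[OF y(1) is_subfield_power[OF R assms(1)] is_subfield_0[OF R] _ this]
      obtain f' where "f' \<in> rat_field" "y \<noteq> 0 \<Longrightarrow> f' \<noteq> 0" "mero_shift f' = a ^ e * f'"
        by auto
      then show False
        using rat_no_semi_invariant[OF assms(1,3) nonconst assms(4)] y by blast
    qed
    have tele: "mero_shift f \<noteq> f + ((mero_deriv ^^ n) (mero_deriv a / a) -
        (\<Sum>i<n. C i * (mero_deriv ^^ i) (mero_deriv a / a)))"
      if f: "f \<in> base_field" and C: "\<And>i. i < n \<Longrightarrow> mero_shift (C i) = C i" for n C f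
    proof
      assume "mero_shift f = f + ((mero_deriv ^^ n) (mero_deriv a / a) -
        (\<Sum>i<n. C i * (mero_deriv ^^ i) (mero_deriv a / a)))"
      then have eq: "mero_shift f = 1 * f + ((mero_deriv ^^ n) (mero_deriv a / a) -
        (\<Sum>i<n. C i * (mero_deriv ^^ i) (mero_deriv a / a)))" by simp
      have "(mero_deriv ^^ i) (mero_deriv a / a) \<in> rat_field" for i
        using assms(1) by (intro mero_deriv_iter_rat_field is_subfield_divide R mero_deriv_rat_field)
      from descent[where g = "\<lambda>i. (mero_deriv ^^ i) (mero_deriv a / a)",
          OF f is_subfield_1[OF R] this C eq]
      show False
        using rat_no_telescoper[OF assms(1,3) nonconst assms(4)] by (metis mult_1)
    qed
    show "\<not> differentially_algebraic mero_deriv base_field z"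
      using differentially_algebraic_imp_algebraic_over_tower[OF K]
        mero.not_algebraic_over_tower[OF K mero_shift_base_field mero_deriv_base_field fixK
          RK[OF assms(1)] assms(3) RK[OF assms(2)] assms(5,6) semi tele] by blast
  next
    assume "a \<in> const_field"
    then obtain l where l: "a = mero_const l" by (auto simp: const_field_def)
    with assms(3) have l0: "l \<noteq> 0" by auto
    show "differentially_algebraic mero_deriv base_field z \<longleftrightarrow>
        (\<exists>f\<in>rat_field. b = mero_shift f - a * f)"
    proof
      assume "differentially_algebraic mero_deriv base_field z"
      then obtain n where alg:
        "algebraic_over (tower base_field (\<lambda>i. (mero_deriv ^^ i) z) n) ((mero_deriv ^^ n) z)"
        using differentially_algebraic_imp_algebraic_over_tower[OF K] by blast
      \<comment> \<open>Because a is constant, differentiation leaves the multiplier unchanged, so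
        all derivatives of z fit one application of \<open>linear_relation\<close>.\<close>
      have z: "mero_shift ((mero_deriv ^^ i) z) = a * (mero_deriv ^^ i) z + (mero_deriv ^^ i) b" for i
      proof (induction i)
        case (Suc i)
        have "mero_shift ((mero_deriv ^^ Suc i) z) = mero_deriv (mero_shift ((mero_deriv ^^ i) z))"
          by (simp add: mero_deriv_shift)
        then show ?case unfolding Suc by (simp add: mero_deriv_add mero_deriv_mult l)
      qed (use assms(5) in simp)
      have bR: "(mero_deriv ^^ i) b \<in> rat_field" for i
        using assms(2) by (rule mero_deriv_iter_rat_field)
      obtain N C f where f: "f \<in> base_field" "\<And>i. i < N \<Longrightarrow> mero_shift (C i) = C i"
        "mero_shift f = a * f + ((mero_deriv ^^ N) b - (\<Sum>i<N. C i * (mero_deriv ^^ i) b))"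
        using mero.linear_relation[of base_field a "\<lambda>i. (mero_deriv ^^ i) b"
            "\<lambda>i. (mero_deriv ^^ i) z" n, OF K mero_shift_base_field fixK RK[OF assms(1)] assms(3)
            RK[OF bR] z alg] by blast
      obtain f' c where "f' \<in> rat_field"
        "mero_shift f' = a * f' +
          ((mero_deriv ^^ N) b - (\<Sum>i<N. mero_const (c i) * (mero_deriv ^^ i) b))"
        using descent[where g = "\<lambda>i. (mero_deriv ^^ i) b", OF f(1) assms(1) bR f(2,3)] by blast
      then show "\<exists>f\<in>rat_field. b = mero_shift f - a * f"
        unfolding l by (intro rat_telescoper_imp_exact[OF l0 assms(2)])
    next
      assume "\<exists>f\<in>rat_field. b = mero_shift f - a * f"
      then obtain f where f: "f \<in> rat_field" "b = mero_shift f - a * f" by blast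
      \<comment> \<open>Both w and its derivative are multiplied by the constant a under \<sigma>,
        so their quotient u is periodic. Then w' = u w is a first-order linear equation for z over
        the base field.\<close>
      define w where "w = z - f"
      have "w \<noteq> 0" using assms(6) RK[OF f(1)] by (auto simp: w_def)
      define u where "u = mero_deriv w / w"
      have "mero_shift w = a * w"
        using assms(5) f(2) by (simp add: w_def mero.hom_diff algebra_simps)
      moreover from this have "mero_shift (mero_deriv w) = a * mero_deriv w"
        by (simp add: l mero_deriv_mult flip: mero_deriv_shift)
      ultimately have "mero_shift u = u" using assms(3) by (simp add: u_def mero.hom_divide)
      then have u: "u \<in> base_field" by (rule fixK)
      have "u * w = mero_deriv z - mero_deriv f"
        using \<open>w \<noteq> 0\<close> by (simp add: u_def) (simp add: w_def mero.D_diff)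
      then have "mero_deriv z = u * z + (mero_deriv f - u * f)"
        by (simp add: w_def algebra_simps)
      then show "differentially_algebraic mero_deriv base_field z"
        using u RK[OF f(1)] K mero_deriv_base_field
        by (intro differentially_algebraic_first_order[OF K u])
           (auto intro!: is_subfield_minus is_subfield_mult)
    qed
  }
qed

end
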